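(* Let $H$ be a complex Hilbert space with $\dim H>1$. Let $\phi:B_s(H)\to B_s(H)$ be a bijective map which preserves the order and the commutativity in both directions, i.e. for all $A,B\in B_s(H)$, \[ A\leq B \Longleftrightarrow \phi(A)\leq\phi(B) \qquad\text{and}\qquad AB=BA \Longleftrightarrow \phi(A)\phi(B)=\phi(B)\phi(A). \] Then there are an either unitary or antiunitary operator $U:H\to H$, a positive scalar $\lambda$, and a real number $\mu$ such that \[ \phi(A)=\lambda UAU^* +\mu I \qquad \text{for all } A\in B_s(H). \]
   Context: $H$ is a complex Hilbert space (of arbitrary, possibly infinite, dimension). $B_s(H)$ denotes the set of all self-adjoint bounded linear operators on $H$, and $I$ is the identity operator. For $A,B\in B_s(H)$, $A\leq B$ means $\langle Ax,x\rangle\leq\langle Bx,x\rangle$ for every $x\in H$. No linearity or continuity of $\phi$ is assumed. An antiunitary operator is a bijective conjugate-linear isometry $U:H\to H$; for such $U$, the adjoint $U^*$ is the conjugate-linear operator determined by $\langle Ux,y\rangle=\langle U^*y,x\rangle$ for all $x,y\in H$, which equals $U^{-1}$. *)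

theory Defs
  imports "HOL-Analysis.Analysis" "HOL-Library.Extended_Nat"
begin

section \<open>Complex Hilbert spaces\<close>

text \<open>
  A complex Hilbert space is presented together with its underlying real Hilbert space structure:
  the real scaling is the restriction of the complex one, and the real inner product is the real
  part of the complex one, so that the norm is the usual one (lemma \<open>cinner_self\<close> below) and
  positive definiteness is inherited from \<^class>\<open>real_inner\<close>. Completeness is part of
  \<^class>\<open>banach\<close>. The complex inner product is linear in its first argument.
\<close>

class chilbert_space = real_inner + banach +
  fixes scaleC :: "complex \<Rightarrow> 'a \<Rightarrow> 'a"  (infixr "*\<^sub>C" 75)
    and cinner :: "'a \<Rightarrow> 'a \<Rightarrow> complex"
  assumes scaleC_add_right: "c *\<^sub>C (x + y) = c *\<^sub>C x + c *\<^sub>C y"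
    and scaleC_add_left: "(c + d) *\<^sub>C x = c *\<^sub>C x + d *\<^sub>C x"
    and scaleC_scaleC: "c *\<^sub>C (d *\<^sub>C x) = (c * d) *\<^sub>C x"
    and scaleC_of_real: "complex_of_real r *\<^sub>C x = r *\<^sub>R x"
    and cinner_commute: "cinner x y = cnj (cinner y x)"
    and cinner_add_left: "cinner (x + y) z = cinner x z + cinner y z"
    and cinner_scaleC_left: "cinner (c *\<^sub>C x) y = c * cinner x y"
    and inner_eq_Re_cinner: "inner x y = Re (cinner x y)"

global_interpretation complex_vector:
  vector_space "scaleC :: complex \<Rightarrow> 'a \<Rightarrow> 'a::chilbert_space"
proof
  show "1 *\<^sub>C x = x" for x :: 'a
    using scaleC_of_real[of 1 x] by simp
qed (simp_all add: scaleC_add_right scaleC_add_left scaleC_scaleC)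

text \<open>
  \<open>complex_vector.dim\<close> counts a basis with \<^const>\<open>card\<close> and is therefore \<open>0\<close> on
  infinite-dimensional spaces; these get dimension \<open>\<infinity>\<close> here.
\<close>

definition complex_dimension :: "'a::chilbert_space itself \<Rightarrow> enat" where
  "complex_dimension TYPE('a) =
     (if \<exists>B::'a set. finite B \<and> complex_vector.span B = UNIV
      then enat (complex_vector.dim (UNIV :: 'a set)) else \<infinity>)"

lemma cinner_self: "cinner x x = complex_of_real ((norm x)\<^sup>2)"
  for x :: "'a::chilbert_space"
proof (rule complex_eqI)
  show "Re (cinner x x) = Re (complex_of_real ((norm x)\<^sup>2))"
    by (simp add: inner_eq_Re_cinner[symmetric] power2_norm_eq_inner)
  show "Im (cinner x x) = Im (complex_of_real ((norm x)\<^sup>2))"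
    using arg_cong[OF cinner_commute[of x x], of Im] by simp
qed

lemma cinner_scaleC_right: "cinner x (c *\<^sub>C y) = cnj c * cinner x y"
  for x :: "'a::chilbert_space"
  by (metis cinner_commute cinner_scaleC_left complex_cnj_mult)

lemma Im_cinner: "Im (cinner x y) = inner x (\<i> *\<^sub>C y)"
  for x :: "'a::chilbert_space"
  by (simp add: inner_eq_Re_cinner cinner_scaleC_right)

instantiation complex :: chilbert_space
begin

definition scaleC_complex :: "complex \<Rightarrow> complex \<Rightarrow> complex" where
  "scaleC_complex c x = c * x"

definition cinner_complex :: "complex \<Rightarrow> complex \<Rightarrow> complex" where
  "cinner_complex x y = x * cnj y"

instance
  by standard
    (simp_all add: scaleC_complex_def cinner_complex_def inner_complex_def
      algebra_simps scaleR_conv_of_real)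

end

instantiation prod :: (chilbert_space, chilbert_space) chilbert_space
begin

definition scaleC_prod :: "complex \<Rightarrow> 'a \<times> 'b \<Rightarrow> 'a \<times> 'b" where
  "scaleC_prod c x = (c *\<^sub>C fst x, c *\<^sub>C snd x)"

definition cinner_prod :: "'a \<times> 'b \<Rightarrow> 'a \<times> 'b \<Rightarrow> complex" where
  "cinner_prod x y = cinner (fst x) (fst y) + cinner (snd x) (snd y)"

instance
proof
  show "cinner x y = cnj (cinner y x)" for x y :: "'a \<times> 'b"
    unfolding cinner_prod_def
    by (simp add: cinner_commute[of "fst x"] cinner_commute[of "snd x"])
qed (simp_all add: scaleC_prod_def cinner_prod_def inner_prod_def scaleC_add_right
    scaleC_add_left scaleC_scaleC scaleC_of_real cinner_add_left cinner_scaleC_left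
    inner_eq_Re_cinner scaleR_prod_def distrib_left)

end

section \<open>Operators\<close>

text \<open>
  Elements of \<open>'a \<Rightarrow>\<^sub>L 'a\<close> are the bounded real-linear maps, so additivity and boundedness
  need not be repeated in the definitions below. Conjugate-linear operators live in the same type.
\<close>

definition complex_linear :: "('a::chilbert_space \<Rightarrow>\<^sub>L 'a) \<Rightarrow> bool" where
  "complex_linear A \<longleftrightarrow> (\<forall>c x. A (c *\<^sub>C x) = c *\<^sub>C A x)"

definition conjugate_linear :: "('a::chilbert_space \<Rightarrow>\<^sub>L 'a) \<Rightarrow> bool" where
  "conjugate_linear A \<longleftrightarrow> (\<forall>c x. A (c *\<^sub>C x) = cnj c *\<^sub>C A x)"

definition selfadjoint_ops :: "('a::chilbert_space \<Rightarrow>\<^sub>L 'a) set" where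
  "selfadjoint_ops =
     {A. complex_linear A \<and> (\<forall>x y. cinner (A x) y = cinner x (A y))}"

text \<open>
  For self-adjoint \<open>A\<close> the number \<open>cinner (A x) x\<close> is real; hence the real parts.
\<close>

definition op_le :: "('a::chilbert_space \<Rightarrow>\<^sub>L 'a) \<Rightarrow> ('a \<Rightarrow>\<^sub>L 'a) \<Rightarrow> bool" where
  "op_le A B \<longleftrightarrow> (\<forall>x. Re (cinner (A x) x) \<le> Re (cinner (B x) x))"

definition unitary :: "('a::chilbert_space \<Rightarrow>\<^sub>L 'a) \<Rightarrow> bool" where
  "unitary U \<longleftrightarrow> complex_linear U \<and> bij U \<and> (\<forall>x. norm (U x) = norm x)"

definition antiunitary :: "('a::chilbert_space \<Rightarrow>\<^sub>L 'a) \<Rightarrow> bool" where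
  "antiunitary U \<longleftrightarrow> conjugate_linear U \<and> bij U \<and> (\<forall>x. norm (U x) = norm x)"

text \<open>The adjoints of a complex-linear and of a conjugate-linear operator, respectively.\<close>

definition cadjoint :: "('a::chilbert_space \<Rightarrow>\<^sub>L 'a) \<Rightarrow> ('a \<Rightarrow>\<^sub>L 'a)" where
  "cadjoint U = (THE V. complex_linear V \<and> (\<forall>x y. cinner (U x) y = cinner x (V y)))"

definition conj_adjoint :: "('a::chilbert_space \<Rightarrow>\<^sub>L 'a) \<Rightarrow> ('a \<Rightarrow>\<^sub>L 'a)" where
  "conj_adjoint U = (THE V. conjugate_linear V \<and> (\<forall>x y. cinner (U x) y = cinner (V y) x))"

text \<open>
  For unitary and antiunitary operators the definite descriptions above are meaningful, and the
  adjoint is the inverse.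
\<close>

lemma isometry_inner:
  fixes U :: "'a::real_inner \<Rightarrow>\<^sub>L 'a"
  assumes "\<And>x. norm (U x) = norm x"
  shows "inner (U x) (U y) = inner x y"
proof -
  have "norm (U x + U y) = norm (x + y)"
    by (metis assms blinfun.add_right)
  then show ?thesis
    by (simp add: dot_norm assms)
qed

lemma isometry_inverse:
  fixes U :: "'a::chilbert_space \<Rightarrow>\<^sub>L 'a"
  assumes "bij U" and iso: "\<And>x. norm (U x) = norm x"
  obtains V :: "'a \<Rightarrow>\<^sub>L 'a" where "\<And>x. U (V x) = x" "\<And>x. V (U x) = x"
proof -
  have UV: "U (inv U x) = x" for x
    using assms(1) by (simp add: bij_is_surj surj_f_inv_f)
  have VU: "inv U (U x) = x" for x
    using assms(1) by (simp add: bij_is_inj)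
  have "bounded_linear (inv U)"
  proof (rule bounded_linear_intro[where K = 1])
    show "inv U (x + y) = inv U x + inv U y" for x y
      by (metis UV VU blinfun.add_right)
    show "inv U (r *\<^sub>R x) = r *\<^sub>R inv U x" for r x
      by (metis UV VU blinfun.scaleR_right)
    show "norm (inv U x) \<le> norm x * 1" for x
      by (metis UV iso mult.right_neutral order_refl)
  qed
  then show thesis
    using that[of "Blinfun (inv U)"] UV VU by (simp add: bounded_linear_Blinfun_apply)
qed

lemma unitary_cadjoint:
  fixes U :: "'a::chilbert_space \<Rightarrow>\<^sub>L 'a"
  assumes "unitary U"
  shows "complex_linear (cadjoint U)"
    and "cinner (U x) y = cinner x (cadjoint U y)"
    and "cadjoint U (U x) = x" and "U (cadjoint U x) = x"
proof -
  have lin: "U (c *\<^sub>C x) = c *\<^sub>C U x" and iso: "norm (U x) = norm x" for c x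
    using assms by (auto simp: unitary_def complex_linear_def)
  obtain V :: "'a \<Rightarrow>\<^sub>L 'a" where V: "\<And>x. U (V x) = x" "\<And>x. V (U x) = x"
    using assms isometry_inverse[of U] by (auto simp: unitary_def)
  have Vlin: "complex_linear V"
    unfolding complex_linear_def by (metis V lin)
  have pres: "cinner (U x) (U y) = cinner x y" for x y
    by (rule complex_eqI)
      (simp_all add: inner_eq_Re_cinner[symmetric] Im_cinner lin[symmetric] isometry_inner iso)
  have Vadj: "cinner (U x) y = cinner x (V y)" for x y
    by (metis V(1) pres)
  have "W = V" if "\<forall>x y. cinner (U x) y = cinner x (W y)" for W :: "'a \<Rightarrow>\<^sub>L 'a"
  proof (rule blinfun_eqI)
    fix y
    have "inner x (W y) = inner x (V y)" for x
      by (metis inner_eq_Re_cinner that Vadj)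
    then show "W y = V y"
      using vector_eq_ldot by blast
  qed
  then have "cadjoint U = V"
    unfolding cadjoint_def using Vlin Vadj by (intro the_equality) auto
  then show "complex_linear (cadjoint U)" "cinner (U x) y = cinner x (cadjoint U y)"
    "cadjoint U (U x) = x" "U (cadjoint U x) = x"
    using Vlin Vadj V by auto
qed

lemma antiunitary_conj_adjoint:
  fixes U :: "'a::chilbert_space \<Rightarrow>\<^sub>L 'a"
  assumes "antiunitary U"
  shows "conjugate_linear (conj_adjoint U)"
    and "cinner (U x) y = cinner (conj_adjoint U y) x"
    and "conj_adjoint U (U x) = x" and "U (conj_adjoint U x) = x"
proof -
  have lin: "U (c *\<^sub>C x) = cnj c *\<^sub>C U x" and iso: "norm (U x) = norm x" for c x
    using assms by (auto simp: antiunitary_def conjugate_linear_def)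
  obtain V :: "'a \<Rightarrow>\<^sub>L 'a" where V: "\<And>x. U (V x) = x" "\<And>x. V (U x) = x"
    using assms isometry_inverse[of U] by (auto simp: antiunitary_def)
  have Vlin: "conjugate_linear V"
    unfolding conjugate_linear_def by (metis V lin complex_cnj_cnj)
  have pres: "cinner (U x) (U y) = cinner y x" for x y
  proof (rule complex_eqI)
    show "Re (cinner (U x) (U y)) = Re (cinner y x)"
      by (simp add: inner_eq_Re_cinner[symmetric] isometry_inner iso inner_commute)
    have "\<i> *\<^sub>C U y = U ((- \<i>) *\<^sub>C y)"
      by (simp only: lin) simp
    then have "Im (cinner (U x) (U y)) = inner x ((- \<i>) *\<^sub>C y)"
      by (simp only: Im_cinner isometry_inner iso)
    also have "\<dots> = - Im (cinner x y)"
      by (simp add: inner_eq_Re_cinner cinner_scaleC_right del: complex_vector.scale_minus_left)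
    also have "\<dots> = Im (cinner y x)"
      by (subst cinner_commute) simp
    finally show "Im (cinner (U x) (U y)) = Im (cinner y x)" .
  qed
  have Vadj: "cinner (U x) y = cinner (V y) x" for x y
    by (metis V(1) pres)
  have "W = V" if "\<forall>x y. cinner (U x) y = cinner (W y) x" for W :: "'a \<Rightarrow>\<^sub>L 'a"
  proof (rule blinfun_eqI)
    fix y
    have "inner (W y) x = inner (V y) x" for x
      by (metis inner_eq_Re_cinner that Vadj)
    then show "W y = V y"
      using vector_eq_rdot by blast
  qed
  then have "conj_adjoint U = V"
    unfolding conj_adjoint_def using Vlin Vadj by (intro the_equality) auto
  then show "conjugate_linear (conj_adjoint U)" "cinner (U x) y = cinner (conj_adjoint U y) x"
    "conj_adjoint U (U x) = x" "U (conj_adjoint U x) = x"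
    using Vlin Vadj V by auto
qed

end

theory Submission
  imports Defs
begin

text \<open>
  Everything is read off from the operators \<open>c I + t P\<close> with \<open>P\<close> a projection onto a line and
  \<open>t > 0\<close>, on which \<open>\<phi>\<close> can be computed.

  Commutativity is used only for the scalars: an operator commuting with all self-adjoint operators is a
  scalar, so \<open>\<phi> (r I) = f r I\<close> for some \<open>f\<close>, and the order makes \<open>f\<close> an increasing bijection
  of the reals. All else uses only the order. A positive operator has rank at most one if and
  only if the operators between \<open>0\<close> and it form a chain (\<open>chain_imp_rank_one\<close>,
  \<open>below_rank_one_comparable\<close>). Hence \<open>\<phi>\<close> turns an increment \<open>t P\<close> into an increment of rank
  one. Comparison with scalars gives its size and comparison of the operators \<open>c I + t P\<close> with each
  other shows that its line does not depend on \<open>c\<close> and \<open>t\<close>. With \<open>Q\<close> the projection onto that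
  line,
  \<open>\<phi> (c I + t P) = f c I + (f (c + t) - f c) Q\<close> (\<open>image_scalar_plus_rank_one_ray_map\<close>).

  The number that ties lines to scalars is the strength of a positive operator \<open>B\<close> along a line,
  the largest \<open>t\<close> with \<open>t P \<le> B\<close>. If \<open>B\<close> has the eigenvalue \<open>a\<close> on a line and \<open>b\<close> on its orthogonal
  complement, the strength along another line is the harmonic mean of \<open>a\<close> and \<open>b\<close> with weights
  \<open>p\<close> and \<open>1 - p\<close>, where the overlap \<open>p\<close> is the squared modulus of the inner product of
  unit vectors on the two lines (\<open>scalar_plus_rank_one_le_iff\<close>).
  As \<open>\<phi>\<close> preserves the order, harmonic means with weight \<open>p\<close> go to harmonic means with weight \<open>q\<close>,
  the overlap of the image lines. For \<open>p = 1 / 2\<close>, which occurs because the dimension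
  exceeds one, this functional equation forces \<open>f\<close> to be affine; feeding the affine \<open>f\<close> back gives
  \<open>p = q\<close> for all pairs of lines. So the map of lines preserves overlaps, and by Wigner's
  theorem it is induced by a unitary or antiunitary \<open>U\<close>.

  Finally, a positive operator is determined by its rank-one lower bounds
  (\<open>positive_eqI_rank_one\<close>). An arbitrary self-adjoint \<open>A\<close> becomes positive after subtracting a
  scalar \<open>c I\<close>, and the operators \<open>c I + t P\<close> below \<open>A\<close> correspond under \<open>\<phi>\<close> to those below \<open>\<phi> A\<close>;
  this gives the formula for \<open>\<phi> A\<close>.
\<close>

section \<open>Inner products and parallel vectors\<close>

lemma cinner_add_right: "cinner x (y + z) = cinner x y + cinner x z"
  for x :: "'a::chilbert_space"
  by (metis cinner_commute cinner_add_left complex_cnj_add)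

lemma cinner_zero_left [simp]: "cinner 0 x = 0"
  for x :: "'a::chilbert_space"
  using cinner_scaleC_left[of 0 x x] by simp

lemma cinner_zero_right [simp]: "cinner x 0 = 0"
  for x :: "'a::chilbert_space"
  using cinner_scaleC_right[of x 0 x] by simp

lemma cinner_minus_left [simp]: "cinner (- x) y = - cinner x y"
  for x :: "'a::chilbert_space"
  using cinner_scaleC_left[of "-1" x y] by simp

lemma cinner_minus_right [simp]: "cinner x (- y) = - cinner x y"
  for x :: "'a::chilbert_space"
  using cinner_scaleC_right[of x "-1" y] by simp

lemma cinner_diff_left: "cinner (x - y) z = cinner x z - cinner y z"
  for x :: "'a::chilbert_space"
  using cinner_add_left[of x "- y" z] by simp

lemma cinner_diff_right: "cinner x (y - z) = cinner x y - cinner x z"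
  for x :: "'a::chilbert_space"
  using cinner_add_right[of x y "- z"] by simp

lemma cinner_scaleR_left: "cinner (r *\<^sub>R x) y = of_real r * cinner x y"
  for x :: "'a::chilbert_space"
  by (simp add: scaleC_of_real[symmetric] cinner_scaleC_left)

lemma cinner_scaleR_right: "cinner x (r *\<^sub>R y) = of_real r * cinner x y"
  for x :: "'a::chilbert_space"
  by (simp add: scaleC_of_real[symmetric] cinner_scaleC_right)

lemmas cinner_simps = cinner_add_left cinner_add_right cinner_diff_left cinner_diff_right
  cinner_scaleC_left cinner_scaleC_right cinner_scaleR_left cinner_scaleR_right

lemma scaleC_scaleR: "c *\<^sub>C (r *\<^sub>R x) = r *\<^sub>R (c *\<^sub>C x)"
  for x :: "'a::chilbert_space"
  by (simp add: scaleC_of_real[symmetric] scaleC_scaleC mult.commute)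

lemma scaleR_scaleC: "r *\<^sub>R (c *\<^sub>C x) = (of_real r * c) *\<^sub>C x"
  for x :: "'a::chilbert_space"
  by (simp add: scaleC_of_real[symmetric] scaleC_scaleC)

lemma scaleC_decomp: "c *\<^sub>C x = Re c *\<^sub>R x + Im c *\<^sub>R (\<i> *\<^sub>C x)"
  for x :: "'a::chilbert_space"
proof -
  have "c *\<^sub>C x = (of_real (Re c) + of_real (Im c) * \<i>) *\<^sub>C x"
    by (subst (1) complex_eq[of c]) (simp add: mult.commute)
  then show ?thesis
    by (simp only: scaleC_add_left scaleC_scaleC[symmetric] scaleC_of_real)
qed

lemma norm_scaleC: "norm (c *\<^sub>C x) = cmod c * norm x"
  for x :: "'a::chilbert_space"
proof -
  have "of_real ((norm (c *\<^sub>C x))\<^sup>2) = c * cnj c * (of_real ((norm x)\<^sup>2) :: complex)"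
    unfolding cinner_self[symmetric] by (simp add: cinner_simps mult.assoc)
  also have "\<dots> = of_real ((cmod c * norm x)\<^sup>2)"
    by (simp add: complex_norm_square[symmetric] power_mult_distrib)
  finally have "(norm (c *\<^sub>C x))\<^sup>2 = (cmod c * norm x)\<^sup>2"
    using of_real_eq_iff by blast
  then show ?thesis by simp
qed

lemma cinner_eq_0_commute: "cinner x y = 0 \<Longrightarrow> cinner y x = 0"
  for x :: "'a::chilbert_space"
  by (subst cinner_commute) simp

lemma cmod_cinner_commute: "cmod (cinner x y) = cmod (cinner y x)"
  for x :: "'a::chilbert_space"
  by (subst cinner_commute) simp

lemma unit_vector_exists: "x \<noteq> 0 \<Longrightarrow> \<exists>e::'a. norm e = 1"
  for x :: "'a::real_normed_vector"
  by (rule exI[of _ "x /\<^sub>R norm x"]) simp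

text \<open>
  A Hermitian quantity is estimated through its real part; rotating one argument by a phase makes
  the complex number real and nonnegative, which turns real estimates into estimates of moduli.
\<close>
lemma unit_rotation: "\<exists>c. cmod c = 1 \<and> c * z = of_real (cmod z)"
proof (cases "z = 0")
  case False
  have "cnj z * z = of_real (cmod z) * of_real (cmod z)"
    by (metis complex_norm_square mult.commute of_real_mult power2_eq_square)
  then have "cmod (cnj z / of_real (cmod z)) = 1 \<and>
      cnj z / of_real (cmod z) * z = of_real (cmod z)"
    using False by (simp add: norm_divide)
  then show ?thesis by blast
qed (auto intro: exI[of _ 1])

text \<open>
  The error of the orthogonal projection onto a line. Its sign is the Cauchy-Schwarz
  inequality and its vanishing is the case of equality.
\<close>
lemma norm_diff_projection:
  fixes x y :: "'a::chilbert_space"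
  assumes "y \<noteq> 0"
  shows "(norm (x - (cinner x y / of_real ((norm y)\<^sup>2)) *\<^sub>C y))\<^sup>2
    = (norm x)\<^sup>2 - (cmod (cinner x y))\<^sup>2 / (norm y)\<^sup>2"
proof -
  let ?k = "cinner x y" and ?n = "of_real ((norm y)\<^sup>2) :: complex"
  have n: "?n \<noteq> 0" using assms by simp
  have k: "?k * cnj ?k = of_real ((cmod ?k)\<^sup>2)"
    by (simp only: complex_norm_square[symmetric])
  have "of_real ((norm (x - c *\<^sub>C y))\<^sup>2) =
      cinner x x - cnj c * ?k - (c * cnj ?k - c * cnj c * ?n)" for c
    by (simp only: cinner_self[symmetric] cinner_simps cinner_commute[of y x])
      (simp add: algebra_simps)
  then have "of_real ((norm (x - (?k / ?n) *\<^sub>C y))\<^sup>2) =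
      cinner x x - cnj (?k / ?n) * ?k - ((?k / ?n) * cnj ?k - (?k / ?n) * cnj (?k / ?n) * ?n)" .
  also have "\<dots> = cinner x x - (?k * cnj ?k) / ?n"
    using n by (simp add: field_simps power2_eq_square)
  also have "\<dots> = of_real ((norm x)\<^sup>2 - (cmod ?k)\<^sup>2 / (norm y)\<^sup>2)"
    unfolding k cinner_self by simp
  finally show ?thesis using of_real_eq_iff by blast
qed

lemma cinner_projection_orthogonal:
  fixes x y :: "'a::chilbert_space"
  assumes "y \<noteq> 0"
  shows "cinner (x - (cinner x y / of_real ((norm y)\<^sup>2)) *\<^sub>C y) y = 0"
  using assms by (simp add: cinner_simps cinner_self)

lemma cmod_cinner_le: "cmod (cinner x y) \<le> norm x * norm y"
  for x :: "'a::chilbert_space"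
proof (cases "y = 0")
  case False
  have "0 \<le> (norm x)\<^sup>2 - (cmod (cinner x y))\<^sup>2 / (norm y)\<^sup>2"
    by (subst norm_diff_projection[OF False, symmetric]) simp
  then have "(cmod (cinner x y))\<^sup>2 \<le> (norm x * norm y)\<^sup>2"
    using False by (simp add: field_simps)
  then show ?thesis by (rule power2_le_imp_le) simp
qed simp

lemma cauchy_schwarz_equality_parallel:
  fixes x y :: "'a::chilbert_space"
  assumes "norm x = norm y" and "cmod (cinner x y) = (norm y)\<^sup>2"
  obtains c where "cmod c = 1" "x = c *\<^sub>C y"
proof (cases "y = 0")
  case True
  then show ?thesis using assms(1) that[of 1] by simp
next
  case False
  let ?c = "cinner x y / of_real ((norm y)\<^sup>2)"
  have "(norm (x - ?c *\<^sub>C y))\<^sup>2 = 0"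
    using False by (subst norm_diff_projection) (simp_all add: assms power2_eq_square)
  then have "x = ?c *\<^sub>C y" by simp
  moreover have "cmod ?c = 1"
    using False assms(2) by (simp add: norm_divide norm_power)
  ultimately show ?thesis using that by blast
qed

section \<open>Wigner's theorem\<close>

lemma additive_isometry_Blinfun:
  fixes U :: "'a::chilbert_space \<Rightarrow> 'a"
  assumes "\<And>x y. U (x + y) = U x + U y" "\<And>r x. U (r *\<^sub>R x) = r *\<^sub>R U x" "\<And>x. norm (U x) = norm x"
  shows "blinfun_apply (Blinfun U) = U"
  by (rule bounded_linear_Blinfun_apply, rule bounded_linear_intro[where K = 1])
    (simp_all add: assms)

text \<open>
  The proof linearises \<open>T\<close> around a unit vector \<open>e\<close>. Each line not orthogonal to \<open>e\<close> has a
  unique representative \<open>e + w\<close> with \<open>w\<close> orthogonal to \<open>e\<close>, and the phase of \<open>T (e + w)\<close> can be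
  chosen so that it becomes \<open>T e + S w\<close>. As \<open>S\<close> preserves the moduli of both
  \<open>\<langle>w, v\<rangle>\<close> and \<open>1 + \<langle>w, v\<rangle>\<close>, it preserves the real part of
  \<open>\<langle>w, v\<rangle>\<close> and is therefore real linear. Moreover \<open>S (\<i> w)\<close> is \<open>\<i> S w\<close> or \<open>- \<i> S w\<close>, and additivity makes the sign the same
  for all \<open>w\<close>.
\<close>
theorem wigner_theorem:
  fixes T :: "'a::chilbert_space \<Rightarrow> 'a"
  assumes pres: "\<And>x y. cmod (cinner (T x) (T y)) = cmod (cinner x y)"
    and surj: "\<And>y. \<exists>c x. y = c *\<^sub>C T x"
  obtains U :: "'a \<Rightarrow>\<^sub>L 'a" where "unitary U \<or> antiunitary U"
    and "\<And>x. \<exists>c. cmod c = 1 \<and> U x = c *\<^sub>C T x"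
proof -
  have normT: "norm (T x) = norm x" for x
  proof -
    have "(norm (T x))\<^sup>2 = (norm x)\<^sup>2"
      using pres[of x x] by (simp add: cinner_self norm_power)
    then show ?thesis by simp
  qed
  show ?thesis
  proof (cases "\<exists>e::'a. norm e = 1")
    case False
    then have z: "x = 0" for x :: 'a using unit_vector_exists by blast
    have "unitary (id_blinfun :: 'a \<Rightarrow>\<^sub>L 'a)"
      unfolding unitary_def complex_linear_def by (simp add: bij_def)
    moreover have "\<exists>c. cmod c = 1 \<and> id_blinfun x = c *\<^sub>C T x" for x
      by (rule exI[of _ 1]) (metis z norm_one)
    ultimately show ?thesis using that by blast
  next
    case True
    then obtain e :: 'a where e: "norm e = 1" by blast
    define e' where "e' = T e"
    have e': "norm e' = 1" by (simp add: e'_def normT e)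
    have ee: "cinner e e = 1" "cinner e' e' = 1" by (simp_all add: cinner_self e e')
    define a where "a w = cinner (T (e + w)) e'" for w
    define S where "S w = cnj (a w) *\<^sub>C T (e + w) - e'" for w
    have cmoda: "cmod (a w) = 1" if "cinner w e = 0" for w
      unfolding a_def e'_def using that by (simp add: pres cinner_simps ee)
    have Seq: "e' + S w = cnj (a w) *\<^sub>C T (e + w)" for w
      by (simp add: S_def)
    have Sorth: "cinner (S w) e' = 0" if "cinner w e = 0" for w
    proof -
      have "cnj (a w) * a w = 1"
        using cmoda[OF that] by (metis complex_norm_square mult.commute of_real_1 one_power2)
      then show ?thesis by (simp add: S_def cinner_simps ee a_def[symmetric])
    qed
    have Sorth': "cinner e' (S w) = 0" if "cinner w e = 0" for w
      using Sorth[OF that] by (subst cinner_commute) simp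
    have norm_plus: "(norm (f + x))\<^sup>2 = (norm f)\<^sup>2 + (norm x)\<^sup>2" if "cinner x f = 0" for f x :: 'a
      by (metis that cinner_commute complex_cnj_zero inner_eq_Re_cinner norm_add_Pythagorean
          orthogonal_def zero_complex.sel(1))
    have normS: "norm (S w) = norm w" if "cinner w e = 0" for w
    proof -
      have "(norm (e' + S w))\<^sup>2 = (norm (e + w))\<^sup>2"
        by (simp add: Seq norm_scaleC cmoda that normT)
      then show ?thesis
        by (simp add: norm_plus that Sorth e e')
    qed
    \<comment> \<open>\<open>e + w\<close> lies in the plane of \<open>e\<close> and \<open>w\<close>, so the image of its line lies in the plane of the image
      lines; this is why \<open>S w\<close> has no component outside the line of \<open>T w\<close>.\<close>
    have S_parallel: "\<exists>c. cmod c = 1 \<and> S w = c *\<^sub>C T w" if w: "cinner w e = 0" for w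
    proof -
      have "cmod (cinner e' (T w)) = 0"
        unfolding e'_def pres using cinner_eq_0_commute[OF w] by simp
      then have "cmod (cinner (S w) (T w)) = cmod (cinner (e' + S w) (T w))"
        by (simp add: cinner_simps)
      also have "\<dots> = cmod (cinner (e + w) w)"
        by (simp add: Seq cinner_simps norm_mult cmoda w pres)
      also have "\<dots> = (norm w)\<^sup>2"
        using w cinner_commute[of e w] by (simp add: cinner_simps cinner_self norm_power)
      finally show ?thesis
        using cauchy_schwarz_equality_parallel[of "S w" "T w"] by (metis normS normT w)
    qed
    have presS: "cmod (cinner (S w) (S v)) = cmod (cinner w v)"
      if "cinner w e = 0" "cinner v e = 0" for w v
      using S_parallel[OF that(1)] S_parallel[OF that(2)]
      by (auto simp: cinner_simps norm_mult pres)
    have ReS: "inner (S w) (S v) = inner w v" if w: "cinner w e = 0" and v: "cinner v e = 0" for w v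
    proof -
      have sq: "(cmod (1 + z))\<^sup>2 = 1 + 2 * Re z + (cmod z)\<^sup>2" for z
        unfolding cmod_power2 by (simp add: power2_eq_square algebra_simps)
      have "1 + cinner (S w) (S v) = cinner (e' + S w) (e' + S v)"
        by (simp add: cinner_simps ee Sorth Sorth' w v)
      also have "cmod \<dots> = cmod (cinner (e + w) (e + v))"
        by (simp add: Seq cinner_simps norm_mult cmoda w v del: cinner_add_left)
          (simp add: cinner_simps[symmetric] pres)
      also have "cinner (e + w) (e + v) = 1 + cinner w v"
        using v cinner_commute[of e v] by (simp add: cinner_simps ee w)
      finally have "2 * Re (cinner (S w) (S v)) = 2 * Re (cinner w v)"
        using sq[of "cinner (S w) (S v)"] sq[of "cinner w v"] presS[OF w v] by simp
      then show ?thesis by (simp add: inner_eq_Re_cinner)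
    qed
    \<comment> \<open>A map that preserves real inner products is real linear: the square of the defect expands
      into inner products, which can be pulled back.\<close>
    have Sadd: "S (w + v) = S w + S v" if w: "cinner w e = 0" and v: "cinner v e = 0" for w v
    proof -
      have "cinner (w + v) e = 0" by (simp add: cinner_simps w v)
      then have "inner (S (w + v) - S w - S v) (S (w + v) - S w - S v) =
          inner (w + v - w - v) (w + v - w - v)"
        by (simp only: inner_diff_left inner_diff_right ReS w v)
      then have "S (w + v) - S w - S v = 0" by simp
      then show ?thesis by (simp add: algebra_simps)
    qed
    have SscaleR: "S (r *\<^sub>R w) = r *\<^sub>R S w" if w: "cinner w e = 0" for r w
    proof -
      have "cinner (r *\<^sub>R w) e = 0" by (simp add: cinner_simps w)
      then have "inner (S (r *\<^sub>R w) - r *\<^sub>R S w) (S (r *\<^sub>R w) - r *\<^sub>R S w) = 0"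
        by (simp add: inner_diff_left inner_diff_right ReS w)
      then show ?thesis by simp
    qed
    \<comment> \<open>The real inner product of \<open>\<i> w\<close> and \<open>w\<close> vanishes, so the factor between their images is imaginary.\<close>
    have Si: "S (\<i> *\<^sub>C w) = \<i> *\<^sub>C S w \<or> S (\<i> *\<^sub>C w) = (- \<i>) *\<^sub>C S w" if w: "cinner w e = 0" for w
    proof (cases "w = 0")
      case True
      then show ?thesis using normS[of 0] by simp
    next
      case False
      have iw: "cinner (\<i> *\<^sub>C w) e = 0" by (simp add: cinner_simps w)
      have "cmod (cinner (S (\<i> *\<^sub>C w)) (S w)) = (norm (S w))\<^sup>2"
        by (simp add: presS iw w normS cinner_simps norm_mult cinner_self norm_power)
      moreover have "norm (S (\<i> *\<^sub>C w)) = norm (S w)"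
        by (simp add: normS iw w norm_scaleC)
      ultimately obtain c where c: "cmod c = 1" "S (\<i> *\<^sub>C w) = c *\<^sub>C S w"
        using cauchy_schwarz_equality_parallel by blast
      have "inner (c *\<^sub>C S w) (S w) = inner (\<i> *\<^sub>C w) w"
        by (simp only: c(2)[symmetric] ReS iw w)
      then have "Re c = 0"
        using False by (simp add: inner_eq_Re_cinner cinner_simps cinner_self normS w)
      with c(1) have "\<bar>Im c\<bar> = 1" by (simp add: cmod_eq_Im)
      with \<open>Re c = 0\<close> have "c = \<i> \<or> c = - \<i>" by (auto simp: complex_eq_iff abs_if split: if_splits)
      with c(2) show ?thesis by auto
    qed
    \<comment> \<open>If different signs occurred at \<open>w\<close> and \<open>v\<close>, neither sign would be possible at \<open>w + v\<close>.\<close>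
    have S_i_uniform: "(\<forall>w. cinner w e = 0 \<longrightarrow> S (\<i> *\<^sub>C w) = \<i> *\<^sub>C S w) \<or>
        (\<forall>w. cinner w e = 0 \<longrightarrow> S (\<i> *\<^sub>C w) = (- \<i>) *\<^sub>C S w)"
    proof (rule ccontr)
      assume "\<not> ?thesis"
      then obtain w v where w: "cinner w e = 0" "S (\<i> *\<^sub>C w) \<noteq> \<i> *\<^sub>C S w"
        and v: "cinner v e = 0" "S (\<i> *\<^sub>C v) \<noteq> (- \<i>) *\<^sub>C S v" by blast
      have w': "S (\<i> *\<^sub>C w) = - (\<i> *\<^sub>C S w)" and v': "S (\<i> *\<^sub>C v) = \<i> *\<^sub>C S v"
        using Si w v by force+
      have wv: "cinner (w + v) e = 0" by (simp add: cinner_simps w v)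
      have "S (\<i> *\<^sub>C (w + v)) = \<i> *\<^sub>C S v - \<i> *\<^sub>C S w"
        by (simp add: scaleC_add_right Sadd cinner_simps w v w' v')
      moreover have "S (\<i> *\<^sub>C (w + v)) = \<i> *\<^sub>C S w + \<i> *\<^sub>C S v \<or>
          S (\<i> *\<^sub>C (w + v)) = - (\<i> *\<^sub>C S w + \<i> *\<^sub>C S v)"
        using Si[OF wv] by (auto simp: Sadd w v scaleC_add_right)
      moreover have "2 *\<^sub>R p = (p + q) - (q - p)" "2 *\<^sub>R q = (q - p) - (- (p + q))" for p q :: 'a
        by (simp_all add: scaleR_2)
      ultimately have "2 *\<^sub>R (\<i> *\<^sub>C S w) = 0 \<or> 2 *\<^sub>R (\<i> *\<^sub>C S v) = 0"
        by (metis diff_self)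
      then have "S w = 0 \<or> S v = 0" by simp
      then show False using w v w' v' by auto
    qed
    \<comment> \<open>\<open>\<kappa>\<close> is the identity in the linear case and conjugation in the conjugate-linear case.\<close>
    obtain \<kappa> :: "complex \<Rightarrow> complex" where
      \<kappa>: "\<kappa> = id \<or> \<kappa> = cnj" and \<kappa>S: "\<And>w. cinner w e = 0 \<Longrightarrow> S (\<i> *\<^sub>C w) = \<kappa> \<i> *\<^sub>C S w"
      using S_i_uniform by (metis complex_cnj_i id_apply)
    have \<kappa>_simps: "\<kappa> (c + d) = \<kappa> c + \<kappa> d" "\<kappa> (c * d) = \<kappa> c * \<kappa> d" "\<kappa> (of_real r) = of_real r"
      "cmod (\<kappa> c) = cmod c" "\<kappa> (\<kappa> c) = c" "\<kappa> 0 = 0" "\<kappa> 1 = 1" for c d r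
      using \<kappa> by auto
    have \<kappa>_decomp: "\<kappa> c = of_real (Re c) + of_real (Im c) * \<kappa> \<i>" for c
      using \<kappa> by (auto simp: complex_eq_iff)
    have SscaleC: "S (c *\<^sub>C w) = \<kappa> c *\<^sub>C S w" if w: "cinner w e = 0" for c w
    proof -
      have "S (c *\<^sub>C w) = Re c *\<^sub>R S w + Im c *\<^sub>R (\<kappa> \<i> *\<^sub>C S w)"
        by (subst scaleC_decomp) (simp add: Sadd SscaleR cinner_simps w \<kappa>S)
      also have "\<dots> = \<kappa> c *\<^sub>C S w"
        by (subst \<kappa>_decomp) (simp only: scaleC_add_left scaleC_scaleC[symmetric] scaleC_of_real)
      finally show ?thesis .
    qed
    define U where "U x = \<kappa> (cinner x e) *\<^sub>C e' + S (x - cinner x e *\<^sub>C e)" for x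
    have orth: "cinner (x - cinner x e *\<^sub>C e) e = 0" for x
      by (simp add: cinner_simps ee)
    have Uadd: "U (x + y) = U x + U y" for x y
    proof -
      have "x + y - cinner (x + y) e *\<^sub>C e = (x - cinner x e *\<^sub>C e) + (y - cinner y e *\<^sub>C e)"
        by (simp add: cinner_simps scaleC_add_left)
      then show ?thesis
        unfolding U_def by (simp only: Sadd orth) (simp add: cinner_simps \<kappa>_simps scaleC_add_left)
    qed
    have UscaleC: "U (c *\<^sub>C x) = \<kappa> c *\<^sub>C U x" for c x
    proof -
      have "c *\<^sub>C x - cinner (c *\<^sub>C x) e *\<^sub>C e = c *\<^sub>C (x - cinner x e *\<^sub>C e)"
        by (simp add: cinner_simps scaleC_scaleC complex_vector.scale_right_diff_distrib)
      then show ?thesis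
        unfolding U_def by (simp only: SscaleC orth)
          (simp add: cinner_simps \<kappa>_simps scaleC_add_right scaleC_scaleC)
    qed
    have UscaleR: "U (r *\<^sub>R x) = r *\<^sub>R U x" for r x
      using UscaleC[of "of_real r" x] by (simp add: \<kappa>_simps scaleC_of_real)
    have normU: "norm (U x) = norm x" for x
    proof -
      have "(norm (U x))\<^sup>2 = (norm (cinner x e *\<^sub>C e))\<^sup>2 + (norm (x - cinner x e *\<^sub>C e))\<^sup>2"
        unfolding U_def
        by (subst norm_plus) (simp_all add: cinner_scaleC_right Sorth[OF orth] normS[OF orth]
            norm_scaleC \<kappa>_simps e e')
      also have "\<dots> = (norm (cinner x e *\<^sub>C e + (x - cinner x e *\<^sub>C e)))\<^sup>2"
        by (rule norm_plus[symmetric]) (simp add: cinner_simps ee)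
      finally show ?thesis by simp
    qed
    have U_parallel: "\<exists>c. cmod c = 1 \<and> U x = c *\<^sub>C T x" for x
    proof (cases "cinner x e = 0")
      case True
      then show ?thesis using S_parallel[of x] by (simp add: U_def \<kappa>_simps)
    next
      case False
      define k where "k = cinner x e"
      define w where "w = inverse k *\<^sub>C x - e"
      have w: "cinner w e = 0" using False by (simp add: w_def k_def cinner_simps ee)
      have x: "x = k *\<^sub>C (e + w)" using False by (simp add: w_def k_def scaleC_scaleC)
      have "U (e + w) = cnj (a w) *\<^sub>C T (e + w)"
        by (simp add: U_def cinner_simps ee w \<kappa>_simps Seq)
      then have "cmod (cinner (U x) (T x)) = cmod k * cmod (cinner (e + w) x)"
        by (subst x, subst UscaleC) (simp add: cinner_scaleC_left norm_mult cmoda w \<kappa>_simps pres)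
      also have "\<dots> = cmod (cinner (k *\<^sub>C (e + w)) x)"
        by (simp only: cinner_scaleC_left norm_mult)
      also have "\<dots> = (norm (T x))\<^sup>2"
        by (simp only: x[symmetric] cinner_self normT norm_of_real) simp
      finally show ?thesis
        using cauchy_schwarz_equality_parallel[of "U x" "T x"] by (metis normU normT)
    qed
    have "inj U"
    proof (rule injI)
      fix x y assume "U x = U y"
      then have "U (x + (-1) *\<^sub>R y) = 0" by (simp only: Uadd UscaleR) simp
      then show "x = y" using normU[of "x + (-1) *\<^sub>R y"] by simp
    qed
    moreover have "\<exists>x. y = U x" for y
    proof -
      obtain c x where "y = c *\<^sub>C T x" using surj by blast
      moreover obtain d where "cmod d = 1" "U x = d *\<^sub>C T x" using U_parallel by blast
      ultimately have "y = U (\<kappa> (c / d) *\<^sub>C x)"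
        by (auto simp: UscaleC \<kappa>_simps scaleC_scaleC)
      then show ?thesis by blast
    qed
    ultimately have "bij U" by (auto simp: bij_def surj_def)
    have app: "blinfun_apply (Blinfun U) = U"
      by (rule additive_isometry_Blinfun) (simp_all add: Uadd UscaleR normU)
    have "unitary (Blinfun U) \<or> antiunitary (Blinfun U)"
      using \<kappa> UscaleC \<open>bij U\<close> normU
      by (auto simp: unitary_def antiunitary_def complex_linear_def conjugate_linear_def app)
    then show ?thesis using that U_parallel by (metis app)
  qed
qed

section \<open>Self-adjoint operators and their order\<close>

lemma op_le_inner: "op_le A B \<longleftrightarrow> (\<forall>x. inner (A x) x \<le> inner (B x) x)"
  by (simp add: op_le_def inner_eq_Re_cinner)

lemma selfadjoint_scaleC: "A \<in> selfadjoint_ops \<Longrightarrow> A (c *\<^sub>C x) = c *\<^sub>C A x"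
  by (simp add: selfadjoint_ops_def complex_linear_def)

lemma selfadjoint_cinner: "A \<in> selfadjoint_ops \<Longrightarrow> cinner (A x) y = cinner x (A y)"
  by (simp add: selfadjoint_ops_def)

lemma selfadjoint_inner: "A \<in> selfadjoint_ops \<Longrightarrow> inner (A x) y = inner x (A y)"
  by (simp add: inner_eq_Re_cinner selfadjoint_cinner)

lemma selfadjoint_cinner_self:
  assumes "A \<in> selfadjoint_ops"
  shows "cinner (A x) x = of_real (inner (A x) x)"
proof (rule complex_eqI)
  have "cinner (A x) x = cnj (cinner (A x) x)"
    by (subst (2) selfadjoint_cinner[OF assms]) (rule cinner_commute)
  then have "Im (cinner (A x) x) = 0" by (metis Reals_cnj_iff complex_is_Real_iff)
  then show "Im (cinner (A x) x) = Im (of_real (inner (A x) x))" by simp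
qed (simp add: inner_eq_Re_cinner)

lemma zero_selfadjoint [simp]: "0 \<in> selfadjoint_ops"
  by (simp add: selfadjoint_ops_def complex_linear_def)

lemma id_selfadjoint [simp]: "id_blinfun \<in> selfadjoint_ops"
  by (simp add: selfadjoint_ops_def complex_linear_def)

lemma add_selfadjoint [simp]:
  "A \<in> selfadjoint_ops \<Longrightarrow> B \<in> selfadjoint_ops \<Longrightarrow> A + B \<in> selfadjoint_ops"
  by (simp add: selfadjoint_ops_def complex_linear_def blinfun.add_left scaleC_add_right cinner_simps)

lemma scaleR_selfadjoint [simp]: "A \<in> selfadjoint_ops \<Longrightarrow> r *\<^sub>R A \<in> selfadjoint_ops"
  by (simp add: selfadjoint_ops_def complex_linear_def blinfun.scaleR_left scaleC_scaleR cinner_simps)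

lemma diff_selfadjoint [simp]:
  "A \<in> selfadjoint_ops \<Longrightarrow> B \<in> selfadjoint_ops \<Longrightarrow> A - B \<in> selfadjoint_ops"
  using add_selfadjoint[of A "(-1) *\<^sub>R B"] scaleR_selfadjoint[of B "-1"] by simp

lemma op_le_refl [simp]: "op_le A A"
  by (simp add: op_le_def)

lemma op_le_trans: "op_le A B \<Longrightarrow> op_le B C \<Longrightarrow> op_le A C"
  unfolding op_le_def by (meson order_trans)

lemma op_le_diff: "op_le (A - C) (B - C) \<longleftrightarrow> op_le A B"
  by (simp add: op_le_inner blinfun.diff_left inner_diff_left)

lemma op_le_add_diff: "op_le (A + C) B \<longleftrightarrow> op_le C (B - A)"
  by (simp add: op_le_inner blinfun.diff_left blinfun.add_left inner_simps le_diff_eq add.commute)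

text \<open>
  A self-adjoint operator with vanishing quadratic form is zero, by polarisation.
\<close>
lemma op_le_antisym:
  assumes A: "A \<in> selfadjoint_ops" and B: "B \<in> selfadjoint_ops" and "op_le A B" "op_le B A"
  shows "A = B"
proof (rule blinfun_eqI)
  fix x
  let ?D = "A - B"
  have D: "?D \<in> selfadjoint_ops" using A B by simp
  have q: "inner (?D y) y = 0" for y
    using assms(3,4) by (simp add: op_le_inner blinfun.diff_left inner_diff_left order_antisym)
  have "inner (?D (x + y)) (x + y) = 2 * inner (?D x) y" for y
    using selfadjoint_inner[OF D, of y x] inner_commute[of y "?D x"]
    by (simp add: blinfun.add_right inner_add_left inner_add_right q)
  then have "inner (?D x) (?D x) = 0" by (simp add: q)
  then show "A x = B x" by (simp add: blinfun.diff_left)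
qed

lemma op_le_scaleR_id: "op_le (s *\<^sub>R id_blinfun :: 'a \<Rightarrow>\<^sub>L 'a) (t *\<^sub>R id_blinfun) \<longleftrightarrow> s \<le> t"
  if "norm (u::'a::chilbert_space) = 1"
proof
  assume "op_le (s *\<^sub>R id_blinfun :: 'a \<Rightarrow>\<^sub>L 'a) (t *\<^sub>R id_blinfun)"
  then have "inner (s *\<^sub>R u) u \<le> inner (t *\<^sub>R u) u"
    unfolding op_le_inner by (metis blinfun.scaleR_left blinfun_apply_id_blinfun)
  then show "s \<le> t" using that by (simp add: dot_square_norm)
qed (simp add: op_le_inner blinfun.scaleR_left mult_right_mono)

text \<open>
  The quadratic form of \<open>B\<close> is nonnegative on the plane of \<open>x\<close> and \<open>y\<close>, so its discriminant there
  is not positive.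
\<close>
lemma positive_cauchy_schwarz_real:
  assumes B: "B \<in> selfadjoint_ops" and pos: "op_le 0 B"
  shows "(inner (B x) y)\<^sup>2 \<le> inner (B x) x * inner (B y) y"
proof -
  have p: "0 \<le> inner (B z) z" for z using pos by (simp add: op_le_inner)
  have "0 \<le> inner (B (r *\<^sub>R x + s *\<^sub>R y)) (r *\<^sub>R x + s *\<^sub>R y)" for r s by (rule p)
  then have q: "0 \<le> r\<^sup>2 * inner (B x) x + 2 * r * s * inner (B x) y + s\<^sup>2 * inner (B y) y" for r s
    using selfadjoint_inner[OF B, of y x]
    by (simp add: blinfun.add_right blinfun.scaleR_right inner_simps inner_commute power2_eq_square
        algebra_simps)
  show ?thesis
  proof (cases "inner (B y) y = 0")
    case True
    have "inner (B x) y = 0"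
    proof (rule ccontr)
      assume n: "inner (B x) y \<noteq> 0"
      \<comment> \<open>The coefficient of \<open>y\<close> is chosen to make the form equal to \<open>- 1\<close>.\<close>
      have "0 \<le> inner (B x) x + 2 * (- (inner (B x) x + 1) / (2 * inner (B x) y)) * inner (B x) y"
        using q[of 1 "- (inner (B x) x + 1) / (2 * inner (B x) y)"] True by simp
      also have "\<dots> = - 1" using n by (simp add: field_simps)
      finally show False by simp
    qed
    then show ?thesis using True by simp
  next
    case False
    then have "0 < inner (B y) y" using p[of y] by simp
    moreover have "0 \<le> inner (B y) y * (inner (B x) x * inner (B y) y - (inner (B x) y)\<^sup>2)"
      using q[of "inner (B y) y" "- inner (B x) y"] by (simp add: power2_eq_square algebra_simps)
    ultimately show ?thesis by (simp add: zero_le_mult_iff)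
  qed
qed

lemma positive_cauchy_schwarz:
  assumes B: "B \<in> selfadjoint_ops" and pos: "op_le 0 B"
  shows "(cmod (cinner (B x) y))\<^sup>2 \<le> inner (B x) x * inner (B y) y"
proof -
  obtain c where c: "cmod c = 1" "c * cinner (B x) y = of_real (cmod (cinner (B x) y))"
    using unit_rotation by blast
  have "inner (B (c *\<^sub>C x)) y = cmod (cinner (B x) y)"
    by (simp add: inner_eq_Re_cinner selfadjoint_scaleC[OF B] cinner_simps c)
  moreover have "inner (B (c *\<^sub>C x)) (c *\<^sub>C x) = inner (B x) x"
  proof -
    have "c * cnj c = 1" using c(1) by (metis complex_norm_square of_real_1 one_power2)
    then have "cinner (c *\<^sub>C B x) (c *\<^sub>C x) = cinner (B x) x"
      by (simp add: cinner_simps mult.commute[of "cnj c"] flip: mult.assoc)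
    then show ?thesis by (simp add: inner_eq_Re_cinner selfadjoint_scaleC[OF B])
  qed
  ultimately show ?thesis using positive_cauchy_schwarz_real[OF B pos, of "c *\<^sub>C x" y] by simp
qed

lemma positive_kernel:
  assumes "B \<in> selfadjoint_ops" "op_le 0 B" "inner (B x) x = 0"
  shows "B x = 0"
  using positive_cauchy_schwarz_real[OF assms(1,2), of x "B x"] assms(3) by simp

lemma scalar_bounds:
  assumes "A \<in> selfadjoint_ops"
  shows "op_le (- norm A *\<^sub>R id_blinfun) A"
  unfolding op_le_inner
proof
  fix x
  have "\<bar>inner (A x) x\<bar> \<le> norm (A x) * norm x" by (rule Cauchy_Schwarz_ineq2)
  also have "\<dots> \<le> norm A * norm x * norm x"
    by (intro mult_right_mono norm_blinfun) simp
  finally show "inner ((- norm A *\<^sub>R id_blinfun) x) x \<le> inner (A x) x"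
    by (simp add: blinfun.scaleR_left dot_square_norm power2_eq_square mult.assoc
        blinfun.minus_left)
qed

section \<open>Rank-one operators\<close>

text \<open>
  For a unit vector \<open>x\<close> this is the projection onto the line of \<open>x\<close>. It does not change with the
  phase of \<open>x\<close>, so \<open>rank_one u = rank_one v\<close> says that unit vectors \<open>u\<close> and \<open>v\<close> span the same line.
\<close>
definition rank_one :: "'a::chilbert_space \<Rightarrow> 'a \<Rightarrow>\<^sub>L 'a" where
  "rank_one x = Blinfun (\<lambda>y. cinner y x *\<^sub>C x)"

lemma rank_one_apply [simp]: "rank_one x y = cinner y x *\<^sub>C x"
proof -
  have "bounded_linear (\<lambda>y. cinner y x *\<^sub>C x)"
  proof (rule bounded_linear_intro[where K = "norm x * norm x"])
    fix y show "norm (cinner y x *\<^sub>C x) \<le> norm y * (norm x * norm x)"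
      using mult_right_mono[OF cmod_cinner_le[of y x], of "norm x"]
      by (simp add: norm_scaleC mult.assoc)
  qed (simp_all add: cinner_simps scaleC_add_left scaleR_scaleC)
  then show ?thesis by (simp add: rank_one_def bounded_linear_Blinfun_apply)
qed

lemma rank_one_selfadjoint [simp]: "rank_one x \<in> selfadjoint_ops"
  by (simp add: selfadjoint_ops_def complex_linear_def cinner_simps scaleC_scaleC
      cinner_commute[of x] mult.commute)

lemma inner_rank_one: "inner (rank_one x y) y = (cmod (cinner y x))\<^sup>2"
proof -
  have "cinner (rank_one x y) y = of_real ((cmod (cinner y x))\<^sup>2)"
    by (simp add: cinner_simps cinner_commute[of x y]) (simp add: complex_norm_square[symmetric])
  then show ?thesis by (simp add: inner_eq_Re_cinner del: rank_one_apply)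
qed

lemma rank_one_scaleC: "rank_one (c *\<^sub>C x) = (cmod c)\<^sup>2 *\<^sub>R rank_one x"
proof (rule blinfun_eqI)
  fix y
  have "cnj c * cinner y x * c = of_real ((cmod c)\<^sup>2) * cinner y x"
    by (simp only: complex_norm_square) (simp only: mult_ac)
  then show "rank_one (c *\<^sub>C x) y = ((cmod c)\<^sup>2 *\<^sub>R rank_one x) y"
    by (simp add: blinfun.scaleR_left cinner_simps scaleC_scaleC scaleR_scaleC)
qed

lemma rank_one_scaleR: "rank_one (r *\<^sub>R x) = r\<^sup>2 *\<^sub>R rank_one x"
  using rank_one_scaleC[of "of_real r" x] by (simp add: scaleC_of_real)

lemma op_le_rank_one_iff:
  "op_le (t *\<^sub>R rank_one u) B \<longleftrightarrow> (\<forall>y. t * (cmod (cinner y u))\<^sup>2 \<le> inner (B y) y)"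
  by (simp add: op_le_inner blinfun.scaleR_left inner_rank_one del: rank_one_apply)

lemma rank_one_eq_iff_parallel:
  assumes "norm u = 1" "norm v = 1"
  shows "rank_one u = rank_one v \<longleftrightarrow> (\<exists>c. cmod c = 1 \<and> u = c *\<^sub>C v)"
proof
  assume eq: "rank_one u = rank_one v"
  have "(cmod (cinner v u))\<^sup>2 = (cmod (cinner v v))\<^sup>2"
    by (simp only: inner_rank_one[symmetric] eq)
  then have "cmod (cinner u v) = (norm v)\<^sup>2"
    using assms by (simp add: cinner_self cmod_cinner_commute[of u] power2_eq_1_iff)
      (metis norm_ge_zero neg_0_le_iff_le not_one_le_zero)
  then show "\<exists>c. cmod c = 1 \<and> u = c *\<^sub>C v"
    using cauchy_schwarz_equality_parallel assms by metis
qed (auto simp: rank_one_scaleC)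

text \<open>
  The form of the larger operator vanishes at the part of \<open>x\<close> orthogonal to \<open>y\<close>, hence so does the
  form of the smaller one.
\<close>
lemma rank_one_le_parallel:
  fixes x y :: "'a::chilbert_space"
  assumes le: "op_le (s *\<^sub>R rank_one x) (t *\<^sub>R rank_one y)" and s: "s > 0" and y: "y \<noteq> 0"
  obtains c where "x = c *\<^sub>C y"
proof -
  let ?c = "cinner x y / of_real ((norm y)\<^sup>2)"
  let ?w = "x - ?c *\<^sub>C y"
  have wy: "cinner ?w y = 0" by (rule cinner_projection_orthogonal[OF y])
  have "s * (cmod (cinner ?w x))\<^sup>2 \<le> t * (cmod (cinner ?w y))\<^sup>2"
    using le unfolding op_le_rank_one_iff
    by (simp add: blinfun.scaleR_left inner_rank_one del: rank_one_apply)
  also have "\<dots> = 0" by (simp only: wy) simp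
  finally have wx: "cinner ?w x = 0" using s by (simp add: mult_le_0_iff)
  have "cinner ?w ?w = 0" by (subst cinner_diff_right) (simp only: cinner_scaleC_right wx wy mult_zero_right diff_zero)
  then have "?w = 0" by (simp only: cinner_self of_real_eq_0_iff) simp
  then show ?thesis using that[of ?c] by simp
qed

lemma unit_rank_one_le:
  fixes u v :: "'a::chilbert_space"
  assumes "op_le (s *\<^sub>R rank_one u) (t *\<^sub>R rank_one v)" "s > 0" "norm u = 1" "norm v = 1"
  shows "rank_one u = rank_one v"
proof -
  obtain c where c: "u = c *\<^sub>C v"
    using rank_one_le_parallel[OF assms(1,2)] assms(4) by (metis norm_zero zero_neq_one)
  then have "cmod c = 1" using assms(3,4) by (simp add: norm_scaleC)
  then show ?thesis by (simp add: c rank_one_scaleC)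
qed

text \<open>
  The Cauchy-Schwarz inequality for the form of \<open>B\<close>, read as a lower bound of \<open>B\<close>. The bound is
  attained at \<open>z\<close>, which makes it useful: it replaces square roots and inverses of \<open>B\<close> throughout.
\<close>
lemma rank_one_le_positive:
  assumes B: "B \<in> selfadjoint_ops" "op_le 0 B" and d: "inner (B z) z > 0"
  shows "op_le ((1 / inner (B z) z) *\<^sub>R rank_one (B z)) B"
  unfolding op_le_rank_one_iff
proof
  fix y
  have "(cmod (cinner y (B z)))\<^sup>2 \<le> inner (B y) y * inner (B z) z"
    using positive_cauchy_schwarz[OF B, of y z] by (simp add: selfadjoint_cinner[OF B(1)])
  then show "1 / inner (B z) z * (cmod (cinner y (B z)))\<^sup>2 \<le> inner (B y) y"
    using d by (simp add: field_simps)
qed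

text \<open>
  At each \<open>z\<close> where it does not vanish the form of \<open>B\<close> agrees with that of a rank-one operator below \<open>B\<close>
  (\<open>rank_one_le_positive\<close>), so the form is the supremum of its rank-one lower bounds.
\<close>
lemma positive_eqI_rank_one:
  assumes B: "B \<in> selfadjoint_ops" "op_le 0 B" and C: "C \<in> selfadjoint_ops" "op_le 0 C"
    and eq: "\<And>t u. t > 0 \<Longrightarrow> norm u = 1 \<Longrightarrow>
      op_le (t *\<^sub>R rank_one u) B \<longleftrightarrow> op_le (t *\<^sub>R rank_one u) C"
  shows "B = C"
proof -
  have *: "op_le B' C'" if B': "B' \<in> selfadjoint_ops" "op_le 0 B'" and C': "op_le 0 C'" and
    imp: "\<And>t u. t > 0 \<Longrightarrow> norm u = 1 \<Longrightarrow>
      op_le (t *\<^sub>R rank_one u) B' \<Longrightarrow> op_le (t *\<^sub>R rank_one u) C'" for B' C' :: "'a \<Rightarrow>\<^sub>L 'a"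
    unfolding op_le_inner
  proof
    fix z
    show "inner (B' z) z \<le> inner (C' z) z"
    proof (cases "inner (B' z) z > 0")
      case False
      moreover have "0 \<le> inner (C' z) z" using C' by (simp add: op_le_inner)
      ultimately show ?thesis by linarith
    next
      case True
      let ?d = "inner (B' z) z" and ?x = "B' z"
      have x: "?x \<noteq> 0" using True by auto
      have "((norm ?x)\<^sup>2 / ?d) *\<^sub>R rank_one (?x /\<^sub>R norm ?x) = (1 / ?d) *\<^sub>R rank_one ?x"
        using x by (simp add: rank_one_scaleR field_simps)
      moreover have "(norm ?x)\<^sup>2 / ?d > 0" "norm (?x /\<^sub>R norm ?x) = 1" using x True by auto
      ultimately have "op_le ((1 / ?d) *\<^sub>R rank_one ?x) C'"
        using imp rank_one_le_positive[OF B' True] by metis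
      then have "1 / ?d * (cmod (cinner z ?x))\<^sup>2 \<le> inner (C' z) z"
        by (simp add: op_le_rank_one_iff)
      moreover have "cmod (cinner z ?x) = ?d"
        using True by (simp add: cmod_cinner_commute[of z] selfadjoint_cinner_self[OF B'(1)])
      ultimately show ?thesis using True by (simp add: power2_eq_square)
    qed
  qed
  show ?thesis
    using op_le_antisym B C * eq by meson
qed

text \<open>
  The strength of \<open>B\<close> along the line of \<open>u = B z\<close>. For invertible \<open>B\<close> the number
  \<open>\<langle>B z, z\<rangle>\<close> is the value at \<open>u\<close> of the quadratic form of the inverse of \<open>B\<close>.
\<close>
lemma rank_one_le_iff_strength:
  assumes B: "B \<in> selfadjoint_ops" "op_le 0 B" and nz: "B z \<noteq> 0"
  shows "op_le (t *\<^sub>R rank_one (B z)) B \<longleftrightarrow> t * inner (B z) z \<le> 1"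
proof -
  let ?d = "inner (B z) z"
  have "0 \<le> ?d" using B(2) by (simp add: op_le_inner)
  then have d: "?d > 0" using positive_kernel[OF B, of z] nz by linarith
  show ?thesis
  proof
    assume "op_le (t *\<^sub>R rank_one (B z)) B"
    then have "t * (cmod (cinner z (B z)))\<^sup>2 \<le> ?d" by (simp add: op_le_rank_one_iff)
    moreover have "cmod (cinner z (B z)) = ?d"
      using d by (simp add: cmod_cinner_commute[of z] selfadjoint_cinner_self[OF B(1)])
    ultimately show "t * ?d \<le> 1" using d by (simp add: power2_eq_square)
  next
    assume "t * ?d \<le> 1"
    then have "t \<le> 1 / ?d" using d by (simp add: field_simps)
    then have "op_le (t *\<^sub>R rank_one (B z)) ((1 / ?d) *\<^sub>R rank_one (B z))"
      using mult_right_mono[of t "1 / ?d"]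
      by (simp add: op_le_rank_one_iff blinfun.scaleR_left inner_rank_one del: rank_one_apply)
    then show "op_le (t *\<^sub>R rank_one (B z)) B"
      using rank_one_le_positive[OF B d] op_le_trans by blast
  qed
qed

text \<open>
  Two vectors \<open>B y\<close>, \<open>B z\<close> in the range of \<open>B\<close> give two rank-one operators below \<open>B\<close>
  (\<open>rank_one_le_positive\<close>), which are incomparable unless the vectors are parallel. So the range is a
  line.
\<close>
lemma chain_imp_rank_one:
  assumes B: "B \<in> selfadjoint_ops" "op_le 0 B" and "B \<noteq> 0"
    and chain: "\<And>C D. C \<in> selfadjoint_ops \<Longrightarrow> D \<in> selfadjoint_ops \<Longrightarrow> op_le 0 C \<Longrightarrow> op_le C B \<Longrightarrow>
      op_le 0 D \<Longrightarrow> op_le D B \<Longrightarrow> op_le C D \<or> op_le D C"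
  obtains t u where "t > 0" "norm u = 1" "B = t *\<^sub>R rank_one u"
proof -
  have d: "inner (B z) z > 0" if "B z \<noteq> 0" for z
    using B(2) positive_kernel[OF B, of z] that by (force simp: op_le_inner less_le)
  obtain z where z: "B z \<noteq> 0" using \<open>B \<noteq> 0\<close> by (metis blinfun_eqI zero_blinfun.rep_eq)
  let ?x = "B z" and ?d = "inner (B z) z"
  have par: "\<exists>k. B y = k *\<^sub>C ?x" for y
  proof (cases "B y = 0")
    case True
    then show ?thesis by (metis complex_vector.scale_zero_left)
  next
    case False
    let ?C = "(1 / ?d) *\<^sub>R rank_one ?x" and ?D = "(1 / inner (B y) y) *\<^sub>R rank_one (B y)"
    have pos: "op_le 0 ((1 / inner (B v) v) *\<^sub>R rank_one (B v))" if "B v \<noteq> 0" for v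
      using d[OF that]
      by (simp add: op_le_inner blinfun.scaleR_left inner_rank_one del: rank_one_apply)
    have "op_le ?C ?D \<or> op_le ?D ?C"
      by (intro chain pos rank_one_le_positive[OF B] d z False) simp_all
    then show ?thesis
    proof
      assume "op_le ?D ?C"
      then show ?thesis
        by (rule rank_one_le_parallel) (use z d[OF False] in auto)
    next
      assume "op_le ?C ?D"
      then obtain c where c: "?x = c *\<^sub>C B y"
        by (rule rank_one_le_parallel) (use False d[OF z] in auto)
      then have "c \<noteq> 0" using z by auto
      then have "B y = inverse c *\<^sub>C ?x" by (subst c) (simp add: scaleC_scaleC)
      then show ?thesis by blast
    qed
  qed
  have "B = (1 / ?d) *\<^sub>R rank_one ?x"
  proof (rule blinfun_eqI)
    fix y
    obtain k where k: "B y = k *\<^sub>C ?x" using par by blast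
    have "cinner y ?x = k * of_real ?d"
      by (simp add: selfadjoint_cinner[OF B(1), symmetric] k cinner_simps
          selfadjoint_cinner_self[OF B(1)])
    then show "B y = ((1 / ?d) *\<^sub>R rank_one ?x) y"
      using d[OF z] by (simp add: blinfun.scaleR_left scaleR_scaleC k)
  qed
  also have "\<dots> = ((norm ?x)\<^sup>2 / ?d) *\<^sub>R rank_one (?x /\<^sub>R norm ?x)"
    using z by (simp add: rank_one_scaleR field_simps)
  finally show ?thesis
    using that[of "(norm ?x)\<^sup>2 / ?d" "?x /\<^sub>R norm ?x"] z d[OF z] by simp
qed

text \<open>
  \<open>C\<close> vanishes on the orthogonal complement of \<open>u\<close>, because the form of the larger operator does, and
  hence maps into the line of \<open>u\<close>.
\<close>
lemma below_rank_one:
  assumes C: "C \<in> selfadjoint_ops" "op_le 0 C" and le: "op_le C (t *\<^sub>R rank_one u)" and u: "norm u = 1"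
  shows "C = inner (C u) u *\<^sub>R rank_one u"
proof (rule blinfun_eqI)
  fix y
  have orth: "C w = 0" if "cinner w u = 0" for w
  proof (rule positive_kernel[OF C])
    have "inner (C w) w \<le> t * (cmod (cinner w u))\<^sup>2"
      using le unfolding op_le_inner
      by (metis blinfun.scaleR_left inner_rank_one inner_scaleR_left)
    then show "inner (C w) w = 0"
      using C(2) that by (simp add: op_le_inner order_antisym)
  qed
  have split: "C x = cinner x u *\<^sub>C C u" for x
  proof -
    have "C (x - cinner x u *\<^sub>C u) = 0"
      by (rule orth) (simp add: cinner_simps cinner_self u)
    then show ?thesis by (simp add: blinfun.diff_right selfadjoint_scaleC[OF C(1)])
  qed
  have "C u - of_real (inner (C u) u) *\<^sub>C u = 0" (is "?v = 0")
  proof -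
    have vu: "cinner ?v u = 0"
      by (simp only: cinner_simps cinner_self u selfadjoint_cinner_self[OF C(1)]) simp
    have "cinner (C u) ?v = 0"
      by (simp only: selfadjoint_cinner[OF C(1)] orth[OF vu] cinner_zero_right)
    then have "cinner ?v ?v = 0"
      using cinner_eq_0_commute[OF vu] by (subst cinner_diff_left) (simp only: cinner_scaleC_left mult_zero_right diff_zero)
    then show ?thesis by (simp only: cinner_self of_real_eq_0_iff) simp
  qed
  then have Cu: "C u = of_real (inner (C u) u) *\<^sub>C u" by simp
  show "C y = (inner (C u) u *\<^sub>R rank_one u) y"
    by (subst split, subst Cu)
      (simp add: blinfun.scaleR_left scaleR_scaleC scaleC_scaleC scaleC_scaleR mult.commute)
qed

text \<open>
  The converse of \<open>chain_imp_rank_one\<close>.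
\<close>
lemma below_rank_one_comparable:
  fixes C D :: "'a::chilbert_space \<Rightarrow>\<^sub>L 'a"
  assumes "C \<in> selfadjoint_ops" "D \<in> selfadjoint_ops" "op_le 0 C" "op_le 0 D"
    "op_le C (t *\<^sub>R rank_one u)" "op_le D (t *\<^sub>R rank_one u)" "norm u = 1"
  shows "op_le C D \<or> op_le D C"
proof -
  have "op_le (r *\<^sub>R rank_one u) (s *\<^sub>R rank_one u)" if "r \<le> s" for r s
    using that by (simp add: op_le_rank_one_iff blinfun.scaleR_left inner_rank_one mult_right_mono
        del: rank_one_apply)
  then show ?thesis
    using below_rank_one[OF assms(1,3,5,7)] below_rank_one[OF assms(2,4,6,7)] by (metis linear)
qed

text \<open>
  Commuting with the rank-one operators makes every vector an eigenvector. The eigenvalue is that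
  of a fixed unit vector \<open>e\<close>: directly for vectors not orthogonal to \<open>e\<close>, and by adding \<open>e\<close> for the
  others.
\<close>
lemma commutes_all_imp_scalar:
  fixes A :: "'a::chilbert_space \<Rightarrow>\<^sub>L 'a"
  assumes A: "A \<in> selfadjoint_ops"
    and comm: "\<And>B. B \<in> selfadjoint_ops \<Longrightarrow> A o\<^sub>L B = B o\<^sub>L A"
  obtains r where "A = r *\<^sub>R id_blinfun"
proof (cases "\<exists>e::'a. norm e = 1")
  case False
  then have z: "x = 0" for x :: 'a using unit_vector_exists by blast
  have "A = 0 *\<^sub>R id_blinfun" by (rule blinfun_eqI) (simp add: z[of "A _"])
  then show ?thesis by (rule that)
next
  case True
  then obtain e :: 'a where e: "norm e = 1" by blast
  define r where "r = inner (A e) e"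
  have sw: "cinner y x *\<^sub>C A x = cinner (A y) x *\<^sub>C x" for x y
    using arg_cong[OF comm[of "rank_one x"], of "\<lambda>F. blinfun_apply F y"]
    by (simp add: selfadjoint_scaleC[OF A])
  have nonorth: "A x = of_real r *\<^sub>C x" if "cinner x e \<noteq> 0" for x
  proof -
    have "cinner e x \<noteq> 0" using that cinner_eq_0_commute by blast
    have "A e = of_real r *\<^sub>C e"
      using sw[of e e] by (simp add: cinner_self e r_def selfadjoint_cinner_self[OF A])
    then have "cinner e x *\<^sub>C A x = cinner e x *\<^sub>C (of_real r *\<^sub>C x)"
      by (simp add: sw cinner_simps scaleC_scaleC mult.commute del: complex_vector.scale_cancel_left)
    then show ?thesis using \<open>cinner e x \<noteq> 0\<close> by (simp only: complex_vector.scale_cancel_left) simp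
  qed
  have "A x = of_real r *\<^sub>C x" for x
  proof (cases "cinner x e = 0")
    case True
    have "cinner (x + e) e \<noteq> 0" "cinner e e \<noteq> 0"
      using True e by (simp_all add: cinner_simps cinner_self)
    then have "A (x + e) = of_real r *\<^sub>C (x + e)" "A e = of_real r *\<^sub>C e"
      using nonorth by blast+
    then show ?thesis by (simp add: blinfun.add_right scaleC_add_right)
  qed (rule nonorth)
  then have "A = r *\<^sub>R id_blinfun"
    by (intro blinfun_eqI) (simp add: blinfun.scaleR_left scaleC_of_real)
  then show ?thesis by (rule that)
qed

section \<open>A functional equation\<close>

lemma nonpos_of_bounded_multiples:
  fixes z c :: real
  assumes "\<And>n::nat. n > 0 \<Longrightarrow> real n * z \<le> c"
  shows "z \<le> 0"
proof (rule ccontr)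
  assume "\<not> z \<le> 0"
  then obtain n where n: "\<bar>c\<bar> < real n * z" using reals_Archimedean3[of z] by auto
  then have "n > 0" by (cases n) auto
  then show False using assms[of n] n by linarith
qed

text \<open>
  The midpoint condition makes \<open>h\<close> affine along every arithmetic progression; refining a progression
  does not change the intercept \<open>E\<close>, which vanishes because \<open>h\<close> has infimum \<open>0\<close>. So \<open>h\<close> is
  homogeneous under multiplication by natural numbers, and monotonicity gives the rest.
\<close>
lemma midpoint_monotone_linear:
  fixes h :: "real \<Rightarrow> real"
  assumes pos: "\<And>x. 0 < x \<Longrightarrow> 0 < h x"
    and mono: "\<And>x y. 0 < x \<Longrightarrow> x < y \<Longrightarrow> h x < h y"
    and small: "\<And>\<epsilon>. 0 < \<epsilon> \<Longrightarrow> \<exists>x>0. h x < \<epsilon>"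
    and mid: "\<And>x y. 0 < x \<Longrightarrow> x < y \<Longrightarrow> h ((x + y) / 2) = (h x + h y) / 2"
    and x: "0 < x"
  shows "h x = h 1 * x"
proof -
  have mono': "h x \<le> h y" if "0 < x" "x \<le> y" for x y
    using mono[of x y] that by (cases "x = y") auto
  have AP: "h (x + real n * d) = h x + real n * (h (x + d) - h x)" if "0 < x" "0 < d" for x d n
  proof -
    have "h (x + real n * d) = h x + real n * (h (x + d) - h x) \<and>
        h (x + real (Suc n) * d) = h x + real (Suc n) * (h (x + d) - h x)"
    proof (induction n)
      case (Suc n)
      let ?y = "x + real n * d"
      have "?y > 0" using that by (simp add: add_pos_nonneg)
      moreover have "(?y + (?y + 2 * d)) / 2 = ?y + d" by (simp add: field_simps)
      moreover have "?y < ?y + 2 * d" using that by simp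
      ultimately have "h (?y + d) = (h ?y + h (?y + 2 * d)) / 2"
        by (metis mid)
      then show ?case using Suc by (simp add: algebra_simps)
    qed simp
    then show ?thesis by blast
  qed
  have double: "h (2 * d) = 2 * h d" if d: "0 < d" for d
  proof -
    define g where "g \<delta> = h (2 * \<delta>) - h \<delta>" for \<delta>
    have lin: "h (real n * \<delta>) = h \<delta> - g \<delta> + real n * g \<delta>" if "0 < \<delta>" "n > 0" for \<delta> n
      using AP[of \<delta> \<delta> "n - 1"] that by (simp add: g_def of_nat_diff algebra_simps)
    \<comment> \<open>\<open>E\<close> is the intercept of the affine function that interpolates \<open>h\<close> on the multiples of \<open>d\<close>; it is
      the same for the multiples of \<open>d / n\<close>.\<close>
    define E where "E = h d - g d"
    have div: "h (d / real n) = E + g d / real n" if n: "n > 0" for n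
    proof -
      have "h d = h (d / n) - g (d / n) + real n * g (d / n)"
        using lin[of "d / n" n] d n by simp
      moreover have "h (2 * d) = h (d / n) - g (d / n) + real (2 * n) * g (d / n)"
        using lin[of "d / n" "2 * n"] d n by simp
      ultimately have "h (d / n) = E + g (d / n)" "g d = real n * g (d / n)"
        by (simp_all add: E_def g_def[of d])
      then show ?thesis using n by simp
    qed
    have "g d > 0" using mono[of d "2 * d"] d by (simp add: g_def)
    have "- E \<le> 0"
    proof (rule nonpos_of_bounded_multiples)
      fix n :: nat assume n: "n > 0"
      have "0 < E + g d / real n" using pos[of "d / n"] div d n by simp
      then show "real n * (- E) \<le> g d" using n by (simp add: field_simps)
    qed
    moreover have "E \<le> 0"
    proof (rule field_le_epsilon)
      fix \<epsilon> :: real assume "0 < \<epsilon>"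
      then obtain x where x: "x > 0" "h x < \<epsilon>" using small by blast
      obtain n where n: "d < real n * x" using reals_Archimedean3[OF x(1)] by blast
      then have "n > 0" using d by (cases n) auto
      then have "h (d / n) \<le> h x" using d n by (intro mono') (simp_all add: field_simps)
      then have "E + g d / n < \<epsilon>" using div \<open>n > 0\<close> x by simp
      moreover have "g d / n > 0" using \<open>g d > 0\<close> \<open>n > 0\<close> by simp
      ultimately show "E \<le> 0 + \<epsilon>" by simp
    qed
    ultimately show ?thesis by (simp add: E_def g_def)
  qed
  have mult: "h (real n * d) = real n * h d" if "0 < d" "n > 0" for n d
    using AP[of d d "n - 1"] double[OF that(1)] that by (simp add: of_nat_diff algebra_simps)
  have "h x - h 1 * x \<le> 0"
  proof (rule nonpos_of_bounded_multiples)
    fix n :: nat assume n: "n > 0"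
    define m where "m = nat \<lfloor>real n * x\<rfloor>"
    have "real n * x \<le> real (Suc m)" unfolding m_def using x by linarith
    moreover have "real m \<le> real n * x" using x by (simp add: m_def)
    moreover have "h (real n * x) \<le> h (real (Suc m) * 1)"
      using calculation x n by (intro mono') simp_all
    ultimately have "real n * h x \<le> real (Suc m) * h 1" "real (Suc m) \<le> real n * x + 1"
      using mult[of x n] mult[of 1 "Suc m"] x n by simp_all
    moreover have "real (Suc m) * h 1 \<le> (real n * x + 1) * h 1"
      using calculation pos[of 1] by (intro mult_right_mono) simp_all
    ultimately show "real n * (h x - h 1 * x) \<le> h 1" by (simp add: algebra_simps)
  qed
  moreover have "h 1 * x - h x \<le> 0"
  proof (rule nonpos_of_bounded_multiples)
    fix n :: nat assume n: "n > 0"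
    define m where "m = nat \<lfloor>real n * x\<rfloor>"
    have m1: "real n * x - 1 \<le> real m" unfolding m_def using x by linarith
    have m2: "real m \<le> real n * x" using x by (simp add: m_def)
    have "real m * h 1 \<le> real n * h x"
    proof (cases "m = 0")
      case True
      then show ?thesis using pos[OF x] by simp
    next
      case False
      then have "h (real m * 1) \<le> h (real n * x)" using m2 by (intro mono') simp_all
      then show ?thesis using mult[of 1 m] mult[OF x n] False by simp
    qed
    moreover have "(real n * x - 1) * h 1 \<le> real m * h 1"
      using m1 pos[of 1] by (intro mult_right_mono) simp_all
    ultimately show "real n * (h 1 * x - h x) \<le> h 1" by (simp add: algebra_simps)
  qed
  ultimately show ?thesis by simp
qed

text \<open>
  For an increasing bijection \<open>F\<close> the last condition on \<open>F\<close> says that it takes the harmonic mean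
  of \<open>a\<close> and \<open>b\<close> to the harmonic mean of \<open>F a\<close> and \<open>F b\<close> with weights \<open>q\<close> and \<open>1 - q\<close>. Passing to reciprocals on both sides gives
  arithmetic means instead.
\<close>
lemma harmonic_mean_equation_linear:
  fixes F :: "real \<Rightarrow> real" and q :: real
  assumes pos: "\<And>t. 0 < t \<Longrightarrow> 0 < F t"
    and mono: "\<And>s t. 0 < s \<Longrightarrow> s < t \<Longrightarrow> F s < F t"
    and surj: "\<And>y. 0 < y \<Longrightarrow> \<exists>t>0. F t = y"
    and q: "0 \<le> q" "q \<le> 1"
    and eq: "\<And>a b t. 0 < b \<Longrightarrow> b < a \<Longrightarrow> 0 < t \<Longrightarrow>
      t * ((1 / 2) / a + (1 / 2) / b) \<le> 1 \<longleftrightarrow> F t * (q / F a + (1 - q) / F b) \<le> 1"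
    and t: "0 < t"
  shows "F t = F 1 * t"
proof -
  define h where "h x = 1 / F (1 / x)" for x
  have hpos: "0 < h x" if "0 < x" for x using pos[of "1 / x"] that by (simp add: h_def)
  have hmono: "h x < h y" if "0 < x" "x < y" for x y
    using pos[of "1 / x"] pos[of "1 / y"] mono[of "1 / y" "1 / x"] that
    by (simp add: h_def divide_strict_left_mono field_simps)
  have hmid: "h ((x + y) / 2) = q * h x + (1 - q) * h y" if x: "0 < x" and xy: "x < y" for x y
  proof -
    define t where "t = 2 / (x + y)"
    define c where "c = q * h x + (1 - q) * h y"
    have t: "t > 0" using x xy by (simp add: t_def)
    have c: "c > 0" unfolding c_def using q hpos[of x] hpos[of y] x xy
      by (cases "q = 0") (simp_all add: add_pos_nonneg)
    have iff: "s * ((x + y) / 2) \<le> 1 \<longleftrightarrow> F s * c \<le> 1" if "0 < s" for s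
      using eq[of "1 / y" "1 / x" s] x xy that
      by (simp add: frac_less2 c_def h_def field_simps)
    have "F t * c \<le> 1" using iff[OF t] x xy by (simp add: t_def)
    moreover have "\<not> F t * c < 1"
    proof
      assume less: "F t * c < 1"
      obtain s where s: "s > 0" "F s = 1 / c" using surj[of "1 / c"] c by auto
      have "F t < F s" using less c by (simp add: s field_simps)
      then have "t < s" using mono[of s t] s(1) by (cases "s = t") force+
      moreover have "s * ((x + y) / 2) \<le> 1" using iff[OF s(1)] s(2) c by simp
      ultimately show False using x xy by (simp add: t_def field_simps)
    qed
    ultimately have "F t * c = 1" by simp
    then have "c = 1 / F t" using pos[OF t] by (simp add: field_simps)
    then show ?thesis by (simp add: h_def c_def t_def)
  qed
  \<comment> \<open>The increments of \<open>h\<close> over \<open>1, 2, 3, 4, 5\<close> form a geometric progression, of ratio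
    \<open>q / (1 - q)\<close>; doubling the step squares this ratio but must reproduce it, so it is \<open>1\<close>.\<close>
  have q_half: "q = 1 / 2"
  proof -
    define d where "d i = h (i + 1) - h i" for i
    have d: "d 1 > 0" "d 2 > 0" "d 3 > 0" "d 4 > 0"
      using hmono[of 1 2] hmono[of 2 3] hmono[of 3 4] hmono[of 4 5] by (simp_all add: d_def)
    have r: "q * d 1 = (1 - q) * d 2" "q * d 2 = (1 - q) * d 3" "q * d 3 = (1 - q) * d 4"
      "q * (d 1 + d 2) = (1 - q) * (d 3 + d 4)"
      using hmid[of 1 3] hmid[of 2 4] hmid[of 3 5] hmid[of 1 5]
      by (simp_all add: d_def algebra_simps)
    have "q \<noteq> 1" using r(1) d by auto
    moreover have "(1 - q) * d 2 = (1 - q) * d 4" using r by (simp add: algebra_simps)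
    ultimately have "d 2 = d 4" by simp
    then have "q * d 2 + q * d 3 = (1 - q) * d 2 + (1 - q) * d 3" using r by simp
    then have "(2 * q - 1) * (d 2 + d 3) = 0" by (simp add: algebra_simps)
    then show ?thesis using d by auto
  qed
  have small: "\<exists>x>0. h x < \<epsilon>" if "0 < \<epsilon>" for \<epsilon>
  proof -
    obtain t where "t > 0" "F t = 2 / \<epsilon>" using surj[of "2 / \<epsilon>"] \<open>0 < \<epsilon>\<close> by auto
    then show ?thesis using \<open>0 < \<epsilon>\<close> by (intro exI[of _ "1 / t"]) (simp add: h_def)
  qed
  have "h (1 / t) = h 1 * (1 / t)"
    by (rule midpoint_monotone_linear[of h])
      (use hpos hmono small hmid t in \<open>simp_all add: q_half add_divide_distrib\<close>)
  then show ?thesis using t pos[OF t] pos[of 1] by (simp add: h_def field_simps)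
qed

section \<open>Pencils of scalar and rank-one operators\<close>

lemma inner_scalar_plus_rank_one:
  "inner ((c *\<^sub>R id_blinfun + t *\<^sub>R rank_one u) y) y = c * (norm y)\<^sup>2 + t * (cmod (cinner y u))\<^sup>2"
  by (simp add: blinfun.add_left blinfun.scaleR_left inner_add_left inner_rank_one
      dot_square_norm del: rank_one_apply)

lemma scalar_plus_rank_one_le_scalar:
  fixes u :: "'a::chilbert_space"
  assumes u: "norm u = 1" and t: "0 \<le> t"
  shows "op_le (c *\<^sub>R id_blinfun + t *\<^sub>R rank_one u) (r *\<^sub>R id_blinfun) \<longleftrightarrow> c + t \<le> r"
proof
  assume "op_le (c *\<^sub>R id_blinfun + t *\<^sub>R rank_one u) (r *\<^sub>R id_blinfun)"
  then have "inner ((c *\<^sub>R id_blinfun + t *\<^sub>R rank_one u) u) u \<le> inner ((r *\<^sub>R id_blinfun) u) u"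
    unfolding op_le_inner by blast
  then show "c + t \<le> r"
    by (simp add: blinfun.add_left blinfun.scaleR_left inner_add_left inner_rank_one cinner_self u
        dot_square_norm del: rank_one_apply)
next
  assume le: "c + t \<le> r"
  show "op_le (c *\<^sub>R id_blinfun + t *\<^sub>R rank_one u) (r *\<^sub>R id_blinfun)"
    unfolding op_le_inner
  proof
    fix y
    have "t * (cmod (cinner y u))\<^sup>2 \<le> t * (norm y)\<^sup>2"
      using cmod_cinner_le[of y u] u t by (intro mult_left_mono power_mono) simp_all
    also have "\<dots> \<le> (r - c) * (norm y)\<^sup>2" using le by (intro mult_right_mono) simp_all
    finally show "inner ((c *\<^sub>R id_blinfun + t *\<^sub>R rank_one u) y) y \<le> inner ((r *\<^sub>R id_blinfun) y) y"
      by (simp add: blinfun.add_left blinfun.scaleR_left inner_add_left inner_rank_one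
          dot_square_norm algebra_simps del: rank_one_apply)
  qed
qed

text \<open>
  The operator on the right, after subtraction of \<open>c I\<close>, has eigenvalue \<open>a - c\<close> on the line of \<open>v\<close> and
  \<open>b - c\<close> on its complement. The condition says that \<open>t\<close> is at most the harmonic mean of these
  eigenvalues with weights \<open>p\<close> and \<open>1 - p\<close>, the squared norms of the components of \<open>u\<close>.
\<close>
lemma scalar_plus_rank_one_le_iff:
  fixes u v :: "'a::chilbert_space"
  assumes u: "norm u = 1" and v: "norm v = 1" and cb: "c < b" and ba: "b < a"
  defines "p \<equiv> (cmod (cinner u v))\<^sup>2"
  shows "op_le (c *\<^sub>R id_blinfun + t *\<^sub>R rank_one u) (b *\<^sub>R id_blinfun + (a - b) *\<^sub>R rank_one v) \<longleftrightarrow>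
    t * (p / (a - c) + (1 - p) / (b - c)) \<le> 1"
proof -
  define \<alpha> where "\<alpha> = a - c"
  define \<beta> where "\<beta> = b - c"
  have ab: "0 < \<beta>" "\<beta> < \<alpha>" "0 < \<alpha>" using cb ba by (simp_all add: \<alpha>_def \<beta>_def)
  define B where "B = \<beta> *\<^sub>R id_blinfun + (\<alpha> - \<beta>) *\<^sub>R rank_one v"
  \<comment> \<open>The solution of \<open>B z = u\<close>: both eigenvalues are inverted.\<close>
  define z where "z = (1 / \<beta>) *\<^sub>R u + (of_real (1 / \<alpha> - 1 / \<beta>) * cinner u v) *\<^sub>C v"
  have B: "B \<in> selfadjoint_ops" by (simp add: B_def)
  have "op_le 0 B" using ab by (simp add: op_le_inner B_def inner_scalar_plus_rank_one)
  have zv: "cinner z v = cinner u v / of_real \<alpha>"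
    using ab by (simp add: z_def cinner_simps cinner_self v field_simps)
  have "B z = (\<beta> *\<^sub>R (1 / \<beta>) *\<^sub>R u) + (of_real \<beta> * (of_real (1 / \<alpha> - 1 / \<beta>) * cinner u v)
      + of_real (\<alpha> - \<beta>) * (cinner u v / of_real \<alpha>)) *\<^sub>C v"
    by (simp only: B_def blinfun.add_left blinfun.scaleR_left rank_one_apply zv
        blinfun_apply_id_blinfun scaleC_add_left scaleR_scaleC[symmetric] scaleC_scaleC[symmetric]
        scaleC_of_real)
      (simp add: z_def scaleC_add_left scaleR_add_right scaleR_scaleC)
  also have "of_real \<beta> * (of_real (1 / \<alpha> - 1 / \<beta>) * cinner u v)
      + of_real (\<alpha> - \<beta>) * (cinner u v / of_real \<alpha>) = 0"
    using ab by (simp add: field_simps)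
  finally have Bz: "B z = u" using ab by simp
  have "cinner u z = of_real (1 / \<beta> + (1 / \<alpha> - 1 / \<beta>) * p)"
    by (simp add: z_def cinner_simps cinner_self u p_def complex_norm_square mult.commute
        del: of_real_diff of_real_divide of_real_power)
  then have uz: "inner u z = p / \<alpha> + (1 - p) / \<beta>"
    by (simp only: inner_eq_Re_cinner Re_complex_of_real)
      (simp add: algebra_simps diff_divide_distrib)
  have "op_le (c *\<^sub>R id_blinfun + t *\<^sub>R rank_one u) (b *\<^sub>R id_blinfun + (a - b) *\<^sub>R rank_one v) \<longleftrightarrow>
      op_le (t *\<^sub>R rank_one u) B"
    by (simp add: op_le_add_diff B_def \<alpha>_def \<beta>_def algebra_simps)
  also have "\<dots> \<longleftrightarrow> t * inner u z \<le> 1"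
    using rank_one_le_iff_strength[OF B \<open>op_le 0 B\<close>, of z t] u
    by (metis Bz norm_zero zero_neq_one)
  finally show ?thesis by (simp add: uz \<alpha>_def \<beta>_def)
qed

text \<open>
  The vectors are \<open>(x + y) / sqrt 2\<close> and \<open>x\<close> for orthonormal \<open>x\<close> and \<open>y\<close>, which exist unless one
  vector spans the space.
\<close>
lemma half_overlap_vectors:
  assumes "complex_dimension TYPE('a::chilbert_space) > 1"
  obtains u v :: "'a::chilbert_space"
  where "norm u = 1" "norm v = 1" "(cmod (cinner u v))\<^sup>2 = 1 / 2"
proof -
  have "\<exists>x y::'a. norm x = 1 \<and> norm y = 1 \<and> cinner x y = 0"
  proof (rule ccontr)
    assume no: "\<not> ?thesis"
    obtain x :: 'a where x: "complex_vector.span {x} = UNIV"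
    proof (cases "\<exists>x::'a. x \<noteq> 0")
      case False
      then have "complex_vector.span {0::'a} = UNIV"
        using complex_vector.span_zero by (metis UNIV_eq_I)
      then show ?thesis using that by blast
    next
      case True
      then obtain x :: 'a where x: "x \<noteq> 0" by blast
      have "y \<in> complex_vector.span {x}" for y
      proof -
        let ?k = "cinner y x / of_real ((norm x)\<^sup>2)"
        let ?w = "y - ?k *\<^sub>C x"
        have "?w = 0"
        proof (rule ccontr)
          assume "?w \<noteq> 0"
          then have "norm (?w /\<^sub>R norm ?w) = 1" by simp
          moreover have "norm (x /\<^sub>R norm x) = 1" using x by simp
          moreover have "cinner (?w /\<^sub>R norm ?w) (x /\<^sub>R norm x) = 0"
            by (simp only: cinner_scaleR_left cinner_scaleR_right
                cinner_projection_orthogonal[OF x] mult_zero_right)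
          ultimately show False using no by blast
        qed
        then have "y = ?k *\<^sub>C x" by simp
        then show ?thesis
          by (metis complex_vector.span_base complex_vector.span_scale singletonI)
      qed
      then show ?thesis using that by blast
    qed
    have "complex_vector.dim (UNIV :: 'a set) \<le> card {x}"
      by (rule complex_vector.dim_le_card) (simp_all add: x)
    moreover have "\<exists>B::'a set. finite B \<and> complex_vector.span B = UNIV" using x by blast
    ultimately have "complex_dimension TYPE('a) \<le> 1"
      by (simp add: complex_dimension_def one_enat_def)
    then show False using assms by simp
  qed
  then obtain x y :: 'a where xy: "norm x = 1" "norm y = 1" "cinner x y = 0" by blast
  let ?u = "(1 / sqrt 2) *\<^sub>R (x + y)"
  have ux: "cinner ?u x = of_real (1 / sqrt 2)"
    using cinner_eq_0_commute[OF xy(3)] by (simp add: cinner_simps cinner_self xy)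
  have "cinner (x + y) (x + y) = of_real 2"
    by (simp only: cinner_simps xy(3) cinner_eq_0_commute[OF xy(3)] cinner_self[of x] cinner_self[of y]
        xy(1,2)) simp
  then have "(norm (x + y))\<^sup>2 = 2" unfolding cinner_self using of_real_eq_iff by blast
  then have "(norm ?u)\<^sup>2 = 1" by (simp add: power_divide)
  then have "norm ?u = 1" by (metis norm_ge_zero power2_eq_1_iff neg_0_le_iff_le not_one_le_zero)
  moreover have "(cmod (cinner ?u x))\<^sup>2 = 1 / 2"
    by (simp only: ux norm_of_real) (simp add: power_divide)
  ultimately show ?thesis using that xy(1) by blast
qed

section \<open>Automorphisms for order and commutativity\<close>

locale order_commutativity_automorphism =
  fixes \<phi> :: "('a::chilbert_space \<Rightarrow>\<^sub>L 'a) \<Rightarrow> ('a \<Rightarrow>\<^sub>L 'a)"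
  assumes bij: "bij_betw \<phi> selfadjoint_ops selfadjoint_ops"
    and order: "\<And>A B. A \<in> selfadjoint_ops \<Longrightarrow> B \<in> selfadjoint_ops \<Longrightarrow>
      op_le A B \<longleftrightarrow> op_le (\<phi> A) (\<phi> B)"
    and commutativity: "\<And>A B. A \<in> selfadjoint_ops \<Longrightarrow> B \<in> selfadjoint_ops \<Longrightarrow>
      A o\<^sub>L B = B o\<^sub>L A \<longleftrightarrow> \<phi> A o\<^sub>L \<phi> B = \<phi> B o\<^sub>L \<phi> A"
begin

lemma image_selfadjoint [simp]: "A \<in> selfadjoint_ops \<Longrightarrow> \<phi> A \<in> selfadjoint_ops"
  using bij by (auto simp: bij_betw_def)

lemma preimage: 
  assumes "B \<in> selfadjoint_ops"
  obtains A where "A \<in> selfadjoint_ops" "\<phi> A = B"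
  using bij assms that by (metis bij_betw_def imageE)

text \<open>
  Scalars are the operators that commute with all others, a property that \<open>\<phi>\<close> preserves.
\<close>
lemma image_scalar: "\<exists>s. \<phi> (r *\<^sub>R id_blinfun) = s *\<^sub>R id_blinfun"
proof -
  have "\<phi> (r *\<^sub>R id_blinfun) o\<^sub>L B = B o\<^sub>L \<phi> (r *\<^sub>R id_blinfun)" if B: "B \<in> selfadjoint_ops" for B
  proof -
    obtain A where A: "A \<in> selfadjoint_ops" "\<phi> A = B" using preimage[OF B] .
    have "(r *\<^sub>R id_blinfun) o\<^sub>L A = A o\<^sub>L (r *\<^sub>R id_blinfun)"
      by (rule blinfun_eqI) (simp add: blinfun.scaleR_left blinfun.scaleR_right)
    then show ?thesis using commutativity[of "r *\<^sub>R id_blinfun" A] A by simp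
  qed
  then show ?thesis
    using commutes_all_imp_scalar[of "\<phi> (r *\<^sub>R id_blinfun)"] by (metis image_selfadjoint
        id_selfadjoint scaleR_selfadjoint)
qed

lemma preimage_scalar: "\<exists>r. \<phi> (r *\<^sub>R id_blinfun) = s *\<^sub>R id_blinfun"
proof -
  obtain A where A: "A \<in> selfadjoint_ops" "\<phi> A = s *\<^sub>R id_blinfun"
    by (rule preimage[of "s *\<^sub>R id_blinfun"]) simp
  have "A o\<^sub>L B = B o\<^sub>L A" if B: "B \<in> selfadjoint_ops" for B
  proof -
    have "\<phi> A o\<^sub>L \<phi> B = \<phi> B o\<^sub>L \<phi> A"
      by (rule blinfun_eqI) (simp add: A(2) blinfun.scaleR_left blinfun.scaleR_right)
    then show ?thesis using commutativity A(1) B by blast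
  qed
  then show ?thesis using commutes_all_imp_scalar[OF A(1)] A(2) by metis
qed

text \<open>
  The function called \<open>f\<close> in the comments.
\<close>
definition scalar_map :: "real \<Rightarrow> real" where
  "scalar_map r = (SOME s. \<phi> (r *\<^sub>R id_blinfun) = s *\<^sub>R id_blinfun)"

lemma image_scalar_eq: "\<phi> (r *\<^sub>R id_blinfun) = scalar_map r *\<^sub>R id_blinfun"
  unfolding scalar_map_def using image_scalar by (rule someI_ex)

text \<open>
  A unit vector is needed to tell the scalar operators apart, as they all coincide on the zero
  space.
\<close>
context
  fixes e :: 'a
  assumes e: "norm e = 1"
begin

lemma scalar_map_le_iff: "scalar_map r \<le> scalar_map s \<longleftrightarrow> r \<le> s"
  using order[of "r *\<^sub>R id_blinfun" "s *\<^sub>R id_blinfun"]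
  by (simp add: image_scalar_eq op_le_scaleR_id[OF e])

lemma scalar_map_less_iff: "scalar_map r < scalar_map s \<longleftrightarrow> r < s"
  by (simp add: scalar_map_le_iff flip: not_le)

lemma scalar_map_surj: "\<exists>r. scalar_map r = s"
proof -
  obtain r where "\<phi> (r *\<^sub>R id_blinfun) = s *\<^sub>R id_blinfun" using preimage_scalar by blast
  then have eq: "scalar_map r *\<^sub>R id_blinfun = (s *\<^sub>R id_blinfun :: 'a \<Rightarrow>\<^sub>L 'a)"
    by (simp only: image_scalar_eq)
  have "scalar_map r \<le> s" "s \<le> scalar_map r"
    by (subst op_le_scaleR_id[OF e, symmetric], simp only: eq op_le_refl)+
  then have "scalar_map r = s" by simp
  then show ?thesis by blast
qed

end

text \<open>
  \<open>\<phi>\<close> maps the order interval from \<open>A\<close> to \<open>A + t P\<close> onto the one between the images. The former is a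
  chain, hence so is the latter.
\<close>
lemma image_rank_one_step:
  assumes A: "A \<in> selfadjoint_ops" and t: "0 < t" and u: "norm u = 1"
  obtains s v where "0 < s" "norm v = 1" "\<phi> (A + t *\<^sub>R rank_one u) = \<phi> A + s *\<^sub>R rank_one v"
proof -
  let ?A' = "A + t *\<^sub>R rank_one u"
  have A': "?A' \<in> selfadjoint_ops" using A by simp
  have le: "op_le A ?A'"
    using t by (simp add: op_le_inner blinfun.add_left blinfun.scaleR_left inner_add_left
        inner_rank_one del: rank_one_apply)
  have "\<phi> ?A' - \<phi> A \<noteq> 0"
  proof
    assume "\<phi> ?A' - \<phi> A = 0"
    then have "?A' = A" using bij A A' by (auto simp: bij_betw_def dest: inj_onD)
    then have "t *\<^sub>R rank_one u = 0" by (metis add_cancel_right_right)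
    then have "(t *\<^sub>R rank_one u) u = 0" by (metis zero_blinfun.rep_eq)
    then show False using t u by (auto simp: blinfun.scaleR_left cinner_self)
  qed
  moreover have "op_le 0 (\<phi> ?A' - \<phi> A)"
    using order[OF A A'] le op_le_diff[of "\<phi> A" "\<phi> A" "\<phi> ?A'"] by simp
  moreover have "op_le C D \<or> op_le D C"
    if CD: "C \<in> selfadjoint_ops" "D \<in> selfadjoint_ops" "op_le 0 C" "op_le C (\<phi> ?A' - \<phi> A)"
      "op_le 0 D" "op_le D (\<phi> ?A' - \<phi> A)" for C D
  proof -
    \<comment> \<open>Operators between \<open>0\<close> and the increment come from operators between \<open>0\<close> and \<open>t P\<close>.\<close>
    have pre: "\<exists>X\<in>selfadjoint_ops. \<phi> X = \<phi> A + E \<and> op_le 0 (X - A) \<and> op_le (X - A) (t *\<^sub>R rank_one u)"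
      if E: "E \<in> selfadjoint_ops" "op_le 0 E" "op_le E (\<phi> ?A' - \<phi> A)" for E
    proof -
      obtain X where X: "X \<in> selfadjoint_ops" "\<phi> X = \<phi> A + E"
        by (rule preimage[of "\<phi> A + E"]) (simp add: A E)
      have "op_le (\<phi> A) (\<phi> X)" "op_le (\<phi> X) (\<phi> ?A')"
        using E op_le_add_diff[of "\<phi> A" 0 "\<phi> X"] op_le_add_diff[of "\<phi> A" E "\<phi> ?A'"]
        by (simp_all add: X(2))
      then have "op_le A X" "op_le X ?A'" using order A A' X(1) by blast+
      then show ?thesis
        using X op_le_diff[of A A X] op_le_diff[of X A ?A'] by auto
    qed
    obtain X Y where XY: "X \<in> selfadjoint_ops" "\<phi> X = \<phi> A + C" "op_le 0 (X - A)"
        "op_le (X - A) (t *\<^sub>R rank_one u)"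
        "Y \<in> selfadjoint_ops" "\<phi> Y = \<phi> A + D" "op_le 0 (Y - A)" "op_le (Y - A) (t *\<^sub>R rank_one u)"
      using pre[of C] pre[of D] CD by blast
    then have "op_le (X - A) (Y - A) \<or> op_le (Y - A) (X - A)"
      using below_rank_one_comparable[of "X - A" "Y - A"] A u by simp
    then have "op_le (\<phi> X) (\<phi> Y) \<or> op_le (\<phi> Y) (\<phi> X)" using order XY by (simp add: op_le_diff)
    then show ?thesis
      using op_le_diff[of "\<phi> X" "\<phi> A" "\<phi> Y"] op_le_diff[of "\<phi> Y" "\<phi> A" "\<phi> X"] by (simp add: XY)
  qed
  ultimately obtain s v where "0 < s" "norm v = 1" "\<phi> ?A' - \<phi> A = s *\<^sub>R rank_one v"
    using chain_imp_rank_one[of "\<phi> ?A' - \<phi> A"] A A' by (metis diff_selfadjoint image_selfadjoint)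
  then show ?thesis using that[of s v] by (metis add.commute diff_add_cancel)
qed

text \<open>
  The size of the increment is found from the scalars above \<open>c I + t P\<close>, the least of which is
  \<open>(c + t) I\<close>.
\<close>
lemma image_scalar_plus_rank_one:
  assumes t: "0 < t" and u: "norm u = 1"
  obtains v where "norm v = 1" "\<phi> (c *\<^sub>R id_blinfun + t *\<^sub>R rank_one u) =
    scalar_map c *\<^sub>R id_blinfun + (scalar_map (c + t) - scalar_map c) *\<^sub>R rank_one v"
proof -
  let ?A = "c *\<^sub>R id_blinfun + t *\<^sub>R rank_one u"
  obtain s v where s: "0 < s" and v: "norm v = 1"
    and eq: "\<phi> ?A = scalar_map c *\<^sub>R id_blinfun + s *\<^sub>R rank_one v"
    by (rule image_rank_one_step[of "c *\<^sub>R id_blinfun", OF _ t u]) (auto simp: image_scalar_eq)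
  have iff: "c + t \<le> r \<longleftrightarrow> scalar_map c + s \<le> scalar_map r" for r
    using order[of ?A "r *\<^sub>R id_blinfun"] t s
    by (simp add: eq image_scalar_eq scalar_plus_rank_one_le_scalar u v)
  obtain r where r: "scalar_map r = scalar_map c + s" using scalar_map_surj[OF u] by blast
  have "scalar_map (c + t) \<le> scalar_map c + s"
    using iff[of r] scalar_map_le_iff[OF u, of "c + t" r] by (simp add: r)
  then have "s = scalar_map (c + t) - scalar_map c" using iff[of "c + t"] by simp
  then show ?thesis using that v eq by simp
qed

text \<open>
  A unit vector on the image of the line of \<open>u\<close>, of arbitrary phase. The operator \<open>\<phi> (rank_one u)\<close>
  serves as the reference that fixes the line for all \<open>c I + t P\<close>.
\<close>
definition ray_map :: "'a \<Rightarrow> 'a" where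
  "ray_map u = (SOME v. norm v = 1 \<and>
    \<phi> (rank_one u) = scalar_map 0 *\<^sub>R id_blinfun + (scalar_map 1 - scalar_map 0) *\<^sub>R rank_one v)"

lemma ray_map_spec:
  assumes "norm u = 1"
  shows "norm (ray_map u) = 1" and "\<phi> (rank_one u) =
    scalar_map 0 *\<^sub>R id_blinfun + (scalar_map 1 - scalar_map 0) *\<^sub>R rank_one (ray_map u)"
proof -
  have "\<exists>v. norm v = 1 \<and> \<phi> (rank_one u) =
      scalar_map 0 *\<^sub>R id_blinfun + (scalar_map 1 - scalar_map 0) *\<^sub>R rank_one v"
    using image_scalar_plus_rank_one[OF zero_less_one assms, of 0] by auto
  from someI_ex[OF this] show "norm (ray_map u) = 1" and "\<phi> (rank_one u) =
    scalar_map 0 *\<^sub>R id_blinfun + (scalar_map 1 - scalar_map 0) *\<^sub>R rank_one (ray_map u)"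
    unfolding ray_map_def by blast+
qed

text \<open>
  Two comparisons move \<open>(c, t)\<close> to \<open>(0, 1)\<close> without changing the image line. With \<open>c\<close> fixed, the
  increments are comparable rank-one operators. With \<open>c + t\<close> fixed, \<open>c' \<le> c\<close> gives
  \<open>c' I + t' P \<le> c I + t P\<close>; both images have the largest eigenvalue \<open>f (c + t)\<close>, attained on
  their lines, so the lines agree.
\<close>
lemma image_scalar_plus_rank_one_ray_map:
  assumes t: "0 < t" and u: "norm u = 1"
  shows "\<phi> (c *\<^sub>R id_blinfun + t *\<^sub>R rank_one u) =
    scalar_map c *\<^sub>R id_blinfun + (scalar_map (c + t) - scalar_map c) *\<^sub>R rank_one (ray_map u)"
proof -
  define V where "V c t v \<longleftrightarrow> norm v = 1 \<and> \<phi> (c *\<^sub>R id_blinfun + t *\<^sub>R rank_one u) =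
    scalar_map c *\<^sub>R id_blinfun + (scalar_map (c + t) - scalar_map c) *\<^sub>R rank_one v" for c t v
  have ex: "\<exists>v. V c t v" if "0 < t" for c t
    using image_scalar_plus_rank_one[OF that u] unfolding V_def by metis
  have less: "scalar_map c < scalar_map (c + t)" if "0 < t" for c t
    using that by (simp add: scalar_map_less_iff[OF u])
  have same_base: "rank_one v = rank_one v'"
    if "V c t v" "V c t' v'" "0 < t" "t \<le> t'" for c t t' v v'
  proof (rule unit_rank_one_le)
    have "op_le (c *\<^sub>R id_blinfun + t *\<^sub>R rank_one u) (c *\<^sub>R id_blinfun + t' *\<^sub>R rank_one u)"
      using that by (simp add: op_le_inner inner_scalar_plus_rank_one mult_right_mono)
    then have "op_le (scalar_map c *\<^sub>R id_blinfun + (scalar_map (c + t) - scalar_map c) *\<^sub>R rank_one v)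
        (scalar_map c *\<^sub>R id_blinfun + (scalar_map (c + t') - scalar_map c) *\<^sub>R rank_one v')"
      using order[of "c *\<^sub>R id_blinfun + t *\<^sub>R rank_one u" "c *\<^sub>R id_blinfun + t' *\<^sub>R rank_one u"] that
      by (simp add: V_def)
    then show "op_le ((scalar_map (c + t) - scalar_map c) *\<^sub>R rank_one v)
        ((scalar_map (c + t') - scalar_map c) *\<^sub>R rank_one v')"
      by (simp add: op_le_add_diff)
  qed (use that less[of t c] in \<open>simp_all add: V_def\<close>)
  have same_top: "rank_one v' = rank_one v"
    if "V c t v" "V c' t' v'" "0 < t" "c' \<le> c" "c' + t' = c + t" for c c' t t' v v'
  proof -
    have v: "norm v = 1" "norm v' = 1" using that by (simp_all add: V_def)
    have "op_le (c' *\<^sub>R id_blinfun + t' *\<^sub>R rank_one u) (c *\<^sub>R id_blinfun + t *\<^sub>R rank_one u)"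
      unfolding op_le_inner inner_scalar_plus_rank_one
    proof
      fix y
      have "(c - c') * (cmod (cinner y u))\<^sup>2 \<le> (c - c') * (norm y)\<^sup>2"
        using cmod_cinner_le[of y u] u that by (intro mult_left_mono power_mono) simp_all
      moreover have t': "t' = t + (c - c')" using that by simp
      ultimately show "c' * (norm y)\<^sup>2 + t' * (cmod (cinner y u))\<^sup>2
          \<le> c * (norm y)\<^sup>2 + t * (cmod (cinner y u))\<^sup>2"
        by (subst t') (simp add: algebra_simps)
    qed
    then have "op_le (scalar_map c' *\<^sub>R id_blinfun + (scalar_map (c' + t') - scalar_map c') *\<^sub>R rank_one v')
        (scalar_map c *\<^sub>R id_blinfun + (scalar_map (c + t) - scalar_map c) *\<^sub>R rank_one v)"
      using order[of "c' *\<^sub>R id_blinfun + t' *\<^sub>R rank_one u" "c *\<^sub>R id_blinfun + t *\<^sub>R rank_one u"] that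
      by (simp add: V_def)
    \<comment> \<open>The inequality is evaluated at \<open>v'\<close>, where the left side takes its largest eigenvalue.\<close>
    then have "scalar_map c' * (norm v')\<^sup>2 + (scalar_map (c' + t') - scalar_map c') * (cmod (cinner v' v'))\<^sup>2
        \<le> scalar_map c * (norm v')\<^sup>2 + (scalar_map (c + t) - scalar_map c) * (cmod (cinner v' v))\<^sup>2"
      unfolding op_le_inner inner_scalar_plus_rank_one by blast
    then have "(scalar_map (c + t) - scalar_map c) * 1
        \<le> (scalar_map (c + t) - scalar_map c) * (cmod (cinner v' v))\<^sup>2"
      using that(5) by (simp add: cinner_self v)
    then have "1 \<le> (cmod (cinner v' v))\<^sup>2"
      using less[OF that(3), of c] by (subst (asm) mult_le_cancel_left_pos) simp_all
    then have "1 \<le> cmod (cinner v' v)"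
      by (metis norm_ge_zero one_power2 power2_le_imp_le)
    then have "cmod (cinner v' v) = (norm v)\<^sup>2"
      using cmod_cinner_le[of v' v] v by simp
    then obtain k where "cmod k = 1" "v' = k *\<^sub>C v"
      using cauchy_schwarz_equality_parallel v by metis
    then show ?thesis by (simp add: rank_one_scaleC)
  qed
  have base: "V 0 1 (ray_map u)" using ray_map_spec[OF u] by (simp add: V_def)
  \<comment> \<open>The two moves meet at \<open>(c, 1 - c)\<close> or at \<open>(0, c + t)\<close>; the sign of \<open>c\<close> decides which of the two
    is sure to have a positive second component.\<close>
  have "rank_one v = rank_one (ray_map u)" if v: "V c t v" for v
  proof (cases "c \<le> 0")
    case True
    obtain w where w: "V c (1 - c) w" using ex[of "1 - c" c] True by auto
    have "rank_one w = rank_one (ray_map u)"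
      using same_top[OF base w] True by simp
    moreover have "rank_one v = rank_one w"
      using same_base[OF v w t] same_base[OF w v] True by (cases "t \<le> 1 - c") simp_all
    ultimately show ?thesis by simp
  next
    case False
    obtain w where w: "V 0 (c + t) w" using ex[of "c + t" 0] t False by auto
    have "rank_one w = rank_one v"
      using same_top[OF v w t] False by simp
    moreover have "rank_one w = rank_one (ray_map u)"
      using same_base[OF base w] same_base[OF w base] t False by (cases "1 \<le> c + t") simp_all
    ultimately show ?thesis by simp
  qed
  then show ?thesis using ex[OF t, of c] by (auto simp: V_def)
qed

text \<open>
  The preimage of \<open>f 0 I + (f 1 - f 0) Q\<close> has rank one by the same chain argument, applied to the
  inverse of \<open>\<phi>\<close>.
\<close>
lemma ray_map_surj:
  assumes v: "norm v = 1"
  obtains u where "norm u = 1" "rank_one (ray_map u) = rank_one v"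
proof -
  let ?f = scalar_map
  let ?B = "?f 0 *\<^sub>R id_blinfun + (?f 1 - ?f 0) *\<^sub>R rank_one v"
  have f01: "?f 0 < ?f 1" by (simp add: scalar_map_less_iff[OF v])
  have phi0: "\<phi> 0 = ?f 0 *\<^sub>R id_blinfun" using image_scalar_eq[of 0] by simp
  obtain A where A: "A \<in> selfadjoint_ops" "\<phi> A = ?B"
    by (rule preimage[of ?B]) simp
  have pos: "op_le 0 A"
    using order[of 0 A] A f01
    by (simp add: phi0 op_le_inner blinfun.add_left blinfun.scaleR_left inner_add_left inner_rank_one
        del: rank_one_apply)
  have "A \<noteq> 0"
  proof
    assume "A = 0"
    then have "(?f 1 - ?f 0) *\<^sub>R rank_one v = 0" using A(2) phi0 by simp
    then have "rank_one v v = 0" using f01 by simp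
    then show False using v by (auto simp: cinner_self)
  qed
  moreover have "op_le C D \<or> op_le D C"
    if CD: "C \<in> selfadjoint_ops" "D \<in> selfadjoint_ops" "op_le 0 C" "op_le C A"
      "op_le 0 D" "op_le D A" for C D
  proof -
    have "op_le 0 (\<phi> E - \<phi> 0) \<and> op_le (\<phi> E - \<phi> 0) ((?f 1 - ?f 0) *\<^sub>R rank_one v)"
      if "E \<in> selfadjoint_ops" "op_le 0 E" "op_le E A" for E
      using that order[of 0 E] order[of E A] A op_le_diff[of "\<phi> 0" "\<phi> 0" "\<phi> E"]
        op_le_diff[of "\<phi> E" "\<phi> 0" "\<phi> A"] by (simp add: phi0)
    then have "op_le (\<phi> C - \<phi> 0) (\<phi> D - \<phi> 0) \<or> op_le (\<phi> D - \<phi> 0) (\<phi> C - \<phi> 0)"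
      using CD v by (intro below_rank_one_comparable[where u = v]) auto
    then show ?thesis using order CD by (simp add: op_le_diff)
  qed
  ultimately obtain t u where tu: "0 < t" "norm u = 1" "A = t *\<^sub>R rank_one u"
    using chain_imp_rank_one[OF A(1) pos] by metis
  have "(?f t - ?f 0) *\<^sub>R rank_one (ray_map u) = (?f 1 - ?f 0) *\<^sub>R rank_one v"
    using image_scalar_plus_rank_one_ray_map[OF tu(1,2), of 0] A(2) by (simp add: tu(3))
  then have "rank_one (ray_map u) = rank_one v"
    using unit_rank_one_le[of "?f t - ?f 0" "ray_map u" "?f 1 - ?f 0" v] v tu ray_map_spec(1)
    by (simp add: scalar_map_less_iff[OF v])
  then show ?thesis using that tu(2) by blast
qed

text \<open>
  \<open>scalar_plus_rank_one_le_iff\<close> before and after applying \<open>\<phi>\<close>.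
\<close>
lemma strength_transfer:
  assumes u: "norm u = 1" and v: "norm v = 1" and cb: "c < b" and ba: "b < a" and t: "0 < t"
  defines "p \<equiv> (cmod (cinner u v))\<^sup>2" and "q \<equiv> (cmod (cinner (ray_map u) (ray_map v)))\<^sup>2"
  shows "t * (p / (a - c) + (1 - p) / (b - c)) \<le> 1 \<longleftrightarrow>
    (scalar_map (c + t) - scalar_map c) *
      (q / (scalar_map a - scalar_map c) + (1 - q) / (scalar_map b - scalar_map c)) \<le> 1"
proof -
  have "t * (p / (a - c) + (1 - p) / (b - c)) \<le> 1 \<longleftrightarrow>
    op_le (c *\<^sub>R id_blinfun + t *\<^sub>R rank_one u) (b *\<^sub>R id_blinfun + (a - b) *\<^sub>R rank_one v)"
    unfolding p_def by (rule scalar_plus_rank_one_le_iff[OF u v cb ba, symmetric])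
  also have "\<dots> \<longleftrightarrow> op_le (\<phi> (c *\<^sub>R id_blinfun + t *\<^sub>R rank_one u))
      (\<phi> (b *\<^sub>R id_blinfun + (a - b) *\<^sub>R rank_one v))"
    by (rule order) simp_all
  also have "\<dots> \<longleftrightarrow> op_le
      (scalar_map c *\<^sub>R id_blinfun + (scalar_map (c + t) - scalar_map c) *\<^sub>R rank_one (ray_map u))
      (scalar_map b *\<^sub>R id_blinfun + (scalar_map a - scalar_map b) *\<^sub>R rank_one (ray_map v))"
    using ba t by (simp add: image_scalar_plus_rank_one_ray_map u v)
  also have "\<dots> \<longleftrightarrow> (scalar_map (c + t) - scalar_map c) *
      (q / (scalar_map a - scalar_map c) + (1 - q) / (scalar_map b - scalar_map c)) \<le> 1"
    unfolding q_def using cb ba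
    by (intro scalar_plus_rank_one_le_iff) (simp_all add: ray_map_spec u v scalar_map_less_iff[OF u])
  finally show ?thesis .
qed

text \<open>
  Two lines with overlap \<open>1 / 2\<close> turn \<open>strength_transfer\<close> into the functional equation for
  \<open>t \<mapsto> f (c + t) - f c\<close>, which is therefore linear for every base point \<open>c\<close>.
\<close>
lemma scalar_map_affine:
  assumes dim: "complex_dimension TYPE('a) > 1"
  shows "scalar_map x = (scalar_map 1 - scalar_map 0) * x + scalar_map 0"
proof -
  obtain u v :: 'a where u: "norm u = 1" and v: "norm v = 1"
    and half: "(cmod (cinner u v))\<^sup>2 = 1 / 2"
    using half_overlap_vectors[OF dim] .
  let ?f = scalar_map
  define q where "q = (cmod (cinner (ray_map u) (ray_map v)))\<^sup>2"
  have "0 \<le> q" by (simp add: q_def)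
  have "q \<le> 1"
    using cmod_cinner_le[of "ray_map u" "ray_map v"] ray_map_spec(1)[OF u] ray_map_spec(1)[OF v]
    by (simp add: q_def power_le_one)
  have lin: "?f (c + t) - ?f c = (?f (c + 1) - ?f c) * t" if "0 < t" for c t
  proof (rule harmonic_mean_equation_linear[of "\<lambda>t. ?f (c + t) - ?f c" q])
    show "\<exists>t>0. ?f (c + t) - ?f c = y" if y: "0 < y" for y
    proof -
      obtain r where r: "?f r = ?f c + y" using scalar_map_surj[OF u] by blast
      then have "c < r" using y scalar_map_less_iff[OF u, of c r] by simp
      then show ?thesis by (intro exI[of _ "r - c"]) (simp add: r)
    qed
    show "t * ((1 / 2) / a + (1 / 2) / b) \<le> 1 \<longleftrightarrow>
        (?f (c + t) - ?f c) * (q / (?f (c + a) - ?f c) + (1 - q) / (?f (c + b) - ?f c)) \<le> 1"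
      if "0 < b" "b < a" "0 < t" for a b t
      using strength_transfer[OF u v, of c "c + b" "c + a" t] that
      unfolding half q_def[symmetric] by simp
  qed (use that \<open>0 \<le> q\<close> \<open>q \<le> 1\<close> in \<open>simp_all add: scalar_map_less_iff[OF u]\<close>)
  consider "x > 0" | "x = 0" | "x < 0" by linarith
  then show ?thesis
  proof cases
    case 1
    then show ?thesis using lin[of x 0] by simp
  next
    case 3
    define k where "k = ?f (x + 1) - ?f x"
    have 0: "?f 0 - ?f x = k * (- x)" and "?f 1 - ?f x = k * (1 - x)"
      using lin[of "- x" x] lin[of "1 - x" x] 3 by (simp_all add: k_def)
    then have k: "?f 1 - ?f 0 = k" by (simp add: algebra_simps)
    show ?thesis unfolding k using 0 by simp
  qed simp
qed

text \<open>
  Once \<open>f\<close> is affine, \<open>strength_transfer\<close> says that the harmonic means of \<open>2\<close> and \<open>1\<close> with first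
  weights \<open>p\<close> and \<open>q\<close> are equal.
\<close>
lemma ray_map_overlap:
  assumes dim: "complex_dimension TYPE('a) > 1" and u: "norm u = 1" and v: "norm v = 1"
  shows "cmod (cinner (ray_map u) (ray_map v)) = cmod (cinner u v)"
proof -
  define l where "l = scalar_map 1 - scalar_map 0"
  have l: "l > 0" by (simp add: l_def scalar_map_less_iff[OF u])
  define p where "p = (cmod (cinner u v))\<^sup>2"
  define q where "q = (cmod (cinner (ray_map u) (ray_map v)))\<^sup>2"
  have p: "p \<le> 1" using cmod_cinner_le[of u v] u v by (simp add: p_def power_le_one)
  have q: "q \<le> 1"
    using cmod_cinner_le[of "ray_map u" "ray_map v"] ray_map_spec(1)[OF u] ray_map_spec(1)[OF v]
    by (simp add: q_def power_le_one)
  have "t * (1 - p / 2) \<le> 1 \<longleftrightarrow> t * (1 - q / 2) \<le> 1" if t: "0 < t" for t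
  proof -
    have f: "scalar_map t - scalar_map 0 = l * t" for t
      using scalar_map_affine[OF dim, of t] by (simp add: l_def)
    have "t * (1 - p / 2) \<le> 1 \<longleftrightarrow> l * t * (q / (l * 2) + (1 - q) / l) \<le> 1"
      using strength_transfer[OF u v, of 0 1 2 t] t f[of t] f[of 1] f[of 2]
      unfolding p_def[symmetric] q_def[symmetric] by simp
    also have "l * t * (q / (l * 2) + (1 - q) / l) = t * (1 - q / 2)"
      using l by (simp add: field_simps)
    finally show ?thesis .
  qed
  from this[of "1 / (1 - p / 2)"] this[of "1 / (1 - q / 2)"] have "p = q"
    using p q by (simp add: field_simps)
  then show ?thesis by (simp add: p_def q_def)
qed

end

section \<open>Conjugation by unitary and antiunitary operators\<close>

text \<open>
  \<open>V\<close> is the adjoint of the unitary or antiunitary \<open>U\<close>; this allows both cases to be treated at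
  once.
\<close>
definition symmetry_adjoint :: "('a::chilbert_space \<Rightarrow>\<^sub>L 'a) \<Rightarrow> ('a \<Rightarrow>\<^sub>L 'a) \<Rightarrow> bool" where
  "symmetry_adjoint U V \<longleftrightarrow> unitary U \<and> V = cadjoint U \<or> antiunitary U \<and> V = conj_adjoint U"

lemma symmetry_adjoint_inverse:
  assumes "symmetry_adjoint U V"
  shows "U (V x) = x" and "norm (U x) = norm x" and "norm (V x) = norm x"
proof -
  show UV: "U (V x) = x" for x
    using assms unitary_cadjoint(4) antiunitary_conj_adjoint(4) by (auto simp: symmetry_adjoint_def)
  show iso: "norm (U x) = norm x" for x
    using assms by (auto simp: symmetry_adjoint_def unitary_def antiunitary_def)
  show "norm (V x) = norm x" by (metis UV iso)
qed

lemma symmetry_adjoint_inner: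
  assumes "symmetry_adjoint U V"
  shows "inner (U x) y = inner x (V y)" and "cmod (cinner y (U x)) = cmod (cinner (V y) x)"
proof -
  have "cinner (U x) y = cinner x (V y) \<or> cinner (U x) y = cinner (V y) x"
    using assms unitary_cadjoint(2)[of U x y] antiunitary_conj_adjoint(2)[of U x y]
    unfolding symmetry_adjoint_def by metis
  then show "inner (U x) y = inner x (V y)" and "cmod (cinner y (U x)) = cmod (cinner (V y) x)"
    by (metis inner_eq_Re_cinner inner_commute, metis cmod_cinner_commute)
qed

lemma conjugation_selfadjoint:
  assumes UV: "symmetry_adjoint U V" and B: "B \<in> selfadjoint_ops"
  shows "U o\<^sub>L B o\<^sub>L V \<in> selfadjoint_ops"
proof -
  from UV consider (lin) "unitary U" "V = cadjoint U" | (conj) "antiunitary U" "V = conj_adjoint U"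
    by (auto simp: symmetry_adjoint_def)
  then show ?thesis
  proof cases
    case lin
    have U: "cinner (U x) y = cinner x (V y)" "U (c *\<^sub>C x) = c *\<^sub>C U x" "V (c *\<^sub>C x) = c *\<^sub>C V x" for x y c
      using unitary_cadjoint(1,2)[OF lin(1)] lin by (simp_all add: complex_linear_def unitary_def)
    have U': "cinner x (U y) = cinner (V x) y" for x y
      by (metis U(1) cinner_commute)
    show ?thesis
      using B by (simp add: selfadjoint_ops_def complex_linear_def U U')
  next
    case conj
    have U: "cinner (U x) y = cinner (V y) x" "U (c *\<^sub>C x) = cnj c *\<^sub>C U x"
        "V (c *\<^sub>C x) = cnj c *\<^sub>C V x" for x y c
      using antiunitary_conj_adjoint(1,2)[OF conj(1)] conj
      by (simp_all add: conjugate_linear_def antiunitary_def)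
    have U': "cinner x (U y) = cinner y (V x)" for x y
      by (metis U(1) cinner_commute)
    show ?thesis
      using B by (simp add: selfadjoint_ops_def complex_linear_def U U')
  qed
qed

text \<open>
  Conjugation by \<open>U\<close> substitutes \<open>V y\<close> for \<open>y\<close> in the quadratic forms, and \<open>V\<close> is surjective.
\<close>
lemma conjugation_le_iff:
  assumes UV: "symmetry_adjoint U V"
  shows "op_le (t *\<^sub>R rank_one (U u)) (U o\<^sub>L B o\<^sub>L V) \<longleftrightarrow> op_le (t *\<^sub>R rank_one u) B"
proof -
  have "(\<forall>y. t * (cmod (cinner (V y) u))\<^sup>2 \<le> inner (B (V y)) (V y)) \<longleftrightarrow>
      (\<forall>y. t * (cmod (cinner y u))\<^sup>2 \<le> inner (B y) y)"
  proof (intro iffI allI)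
    fix y assume *: "\<forall>y. t * (cmod (cinner (V y) u))\<^sup>2 \<le> inner (B (V y)) (V y)"
    have "V (U y) = y"
      using symmetry_adjoint_inverse(1)[OF UV, of "U y"] symmetry_adjoint_inverse(2)[OF UV, of "V (U y) - y"]
      by (simp add: blinfun.diff_right)
    then show "t * (cmod (cinner y u))\<^sup>2 \<le> inner (B y) y" using * by metis
  qed blast
  then show ?thesis
    by (simp add: op_le_rank_one_iff symmetry_adjoint_inner[OF UV])
qed

section \<open>Structure of the automorphisms\<close>

context order_commutativity_automorphism
begin

text \<open>
  \<open>T\<close> extends \<open>ray_map\<close> from unit vectors to all vectors by homogeneity.
\<close>
lemma ray_map_wigner:
  assumes dim: "complex_dimension TYPE('a) > 1"
  obtains U :: "'a \<Rightarrow>\<^sub>L 'a" where "unitary U \<or> antiunitary U"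
    and "\<And>u. norm u = 1 \<Longrightarrow> rank_one (U u) = rank_one (ray_map u)"
proof -
  define T where "T x = norm x *\<^sub>R ray_map (x /\<^sub>R norm x)" for x
  have pres: "cmod (cinner (T x) (T y)) = cmod (cinner x y)" for x y
  proof (cases "x = 0 \<or> y = 0")
    case False
    let ?x = "x /\<^sub>R norm x" and ?y = "y /\<^sub>R norm y"
    have "cmod (cinner (T x) (T y)) = norm x * norm y * cmod (cinner (ray_map ?x) (ray_map ?y))"
      by (simp only: T_def cinner_scaleR_left cinner_scaleR_right norm_mult) simp
    also have "cmod (cinner (ray_map ?x) (ray_map ?y)) = cmod (cinner ?x ?y)"
      using False by (intro ray_map_overlap[OF dim]) simp_all
    also have "norm x * norm y * \<dots> = cmod (cinner (norm x *\<^sub>R ?x) (norm y *\<^sub>R ?y))"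
      by (simp only: cinner_scaleR_left cinner_scaleR_right norm_mult) simp
    also have "\<dots> = cmod (cinner x y)" using False by simp
    finally show ?thesis .
  qed (auto simp: T_def)
  have T_unit: "T u = ray_map u" if "norm u = 1" for u
    using that by (simp add: T_def)
  have surj: "\<exists>c x. y = c *\<^sub>C T x" for y
  proof (cases "y = 0")
    case True
    then show ?thesis by (intro exI[of _ 0]) simp
  next
    case False
    then have v: "norm (y /\<^sub>R norm y) = 1" by simp
    obtain u where u: "norm u = 1" "rank_one (ray_map u) = rank_one (y /\<^sub>R norm y)"
      using ray_map_surj[OF v] .
    then obtain c where "y /\<^sub>R norm y = c *\<^sub>C ray_map u"
      using rank_one_eq_iff_parallel[OF v, of "ray_map u"] ray_map_spec(1) by metis
    then have "y = norm y *\<^sub>R (c *\<^sub>C T u)"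
      using False by (simp add: T_unit u(1)) (metis norm_eq_zero scaleR_one right_inverse scaleR_scaleR)
    then show ?thesis by (metis scaleR_scaleC)
  qed
  obtain U :: "'a \<Rightarrow>\<^sub>L 'a" where U: "unitary U \<or> antiunitary U"
    "\<And>x. \<exists>c. cmod c = 1 \<and> U x = c *\<^sub>C T x"
    using wigner_theorem[of T] pres surj by blast
  have "rank_one (U u) = rank_one (ray_map u)" if "norm u = 1" for u
    using U(2)[of u] by (auto simp: rank_one_scaleC T_unit[OF that])
  with U(1) show ?thesis by (rule that)
qed

text \<open>
  After subtraction of scalars both sides are positive, so it suffices to compare the rank-one
  operators below them. The factor \<open>l\<close> is the slope of \<open>f\<close>.
\<close>
lemma automorphism_form:
  assumes dim: "complex_dimension TYPE('a) > 1"
    and UV: "symmetry_adjoint U V"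
    and ray: "\<And>u. norm u = 1 \<Longrightarrow> rank_one (U u) = rank_one (ray_map u)"
    and A: "A \<in> selfadjoint_ops"
  defines "l \<equiv> scalar_map 1 - scalar_map 0"
  assumes l: "l > 0"
  shows "\<phi> A = l *\<^sub>R (U o\<^sub>L A o\<^sub>L V) + scalar_map 0 *\<^sub>R id_blinfun"
proof -
  \<comment> \<open>Any scalar lower bound \<open>c I\<close> of \<open>A\<close> would do.\<close>
  define c where "c = - norm A"
  define B where "B = A - c *\<^sub>R id_blinfun"
  have B: "B \<in> selfadjoint_ops" using A by (simp add: B_def)
  have cA: "op_le (c *\<^sub>R id_blinfun) A" unfolding c_def by (rule scalar_bounds[OF A])
  have affine: "scalar_map x = l * x + scalar_map 0" for x
    unfolding l_def by (rule scalar_map_affine[OF dim])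
  have "\<phi> A - scalar_map c *\<^sub>R id_blinfun = l *\<^sub>R (U o\<^sub>L B o\<^sub>L V)"
  proof (rule positive_eqI_rank_one)
    show "\<phi> A - scalar_map c *\<^sub>R id_blinfun \<in> selfadjoint_ops"
      and "l *\<^sub>R (U o\<^sub>L B o\<^sub>L V) \<in> selfadjoint_ops"
      using A B conjugation_selfadjoint[OF UV] by simp_all
    show "op_le 0 (\<phi> A - scalar_map c *\<^sub>R id_blinfun)"
      using order[of "c *\<^sub>R id_blinfun" A] cA A
        op_le_add_diff[of "scalar_map c *\<^sub>R id_blinfun" 0 "\<phi> A"]
      by (simp add: image_scalar_eq)
    have "op_le 0 B" using cA op_le_add_diff[of "c *\<^sub>R id_blinfun" 0 A] by (simp add: B_def)
    then show "op_le 0 (l *\<^sub>R (U o\<^sub>L B o\<^sub>L V))"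
      using l by (simp add: op_le_inner blinfun.scaleR_left symmetry_adjoint_inner[OF UV])
    fix t :: real and w :: 'a assume t: "t > 0" and w: "norm w = 1"
    define u where "u = V w"
    have u: "norm u = 1" and Uu: "U u = w"
      using symmetry_adjoint_inverse[OF UV] w by (simp_all add: u_def)
    have "op_le (t *\<^sub>R rank_one w) (\<phi> A - scalar_map c *\<^sub>R id_blinfun) \<longleftrightarrow>
        op_le (scalar_map c *\<^sub>R id_blinfun + t *\<^sub>R rank_one (ray_map u)) (\<phi> A)"
      by (simp add: op_le_add_diff ray[OF u, symmetric] Uu)
    also have "scalar_map c *\<^sub>R id_blinfun + t *\<^sub>R rank_one (ray_map u) =
        \<phi> (c *\<^sub>R id_blinfun + (t / l) *\<^sub>R rank_one u)"
    proof -
      have "l * (c + t / l) = l * c + t" using l by (simp add: distrib_left)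
      then have "scalar_map (c + t / l) - scalar_map c = t"
        by (simp only: affine[of "c + t / l"] affine[of c])
      moreover have "0 < t / l" using t l by simp
      ultimately show ?thesis
        using image_scalar_plus_rank_one_ray_map[of "t / l" u c] u by (simp only:)
    qed
    also have "op_le \<dots> (\<phi> A) \<longleftrightarrow> op_le ((t / l) *\<^sub>R rank_one u) B"
      using order[of "c *\<^sub>R id_blinfun + (t / l) *\<^sub>R rank_one u" A] A
      by (simp add: op_le_add_diff B_def)
    also have "\<dots> \<longleftrightarrow> op_le ((t / l) *\<^sub>R rank_one w) (U o\<^sub>L B o\<^sub>L V)"
      using conjugation_le_iff[OF UV, of "t / l" u B] by (simp add: Uu)
    also have "\<dots> \<longleftrightarrow> op_le (t *\<^sub>R rank_one w) (l *\<^sub>R (U o\<^sub>L B o\<^sub>L V))"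
      using l by (simp add: op_le_rank_one_iff blinfun.scaleR_left field_simps)
    finally show "op_le (t *\<^sub>R rank_one w) (\<phi> A - scalar_map c *\<^sub>R id_blinfun) \<longleftrightarrow>
        op_le (t *\<^sub>R rank_one w) (l *\<^sub>R (U o\<^sub>L B o\<^sub>L V))" .
  qed
  moreover have "U o\<^sub>L B o\<^sub>L V = (U o\<^sub>L A o\<^sub>L V) - c *\<^sub>R id_blinfun"
    by (rule blinfun_eqI)
      (simp add: B_def blinfun.diff_left blinfun.diff_right blinfun.scaleR_left blinfun.scaleR_right
        symmetry_adjoint_inverse[OF UV])
  ultimately show ?thesis
    by (simp add: affine[of c] algebra_simps)
qed

end

theorem corollary3:
  fixes \<phi> :: "('a::chilbert_space \<Rightarrow>\<^sub>L 'a) \<Rightarrow> ('a \<Rightarrow>\<^sub>L 'a)"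
  assumes dim: "complex_dimension TYPE('a) > 1"
    and bij: "bij_betw \<phi> selfadjoint_ops selfadjoint_ops"
    and order: "\<And>A B. A \<in> selfadjoint_ops \<Longrightarrow> B \<in> selfadjoint_ops \<Longrightarrow>
      op_le A B \<longleftrightarrow> op_le (\<phi> A) (\<phi> B)"
    and commutativity: "\<And>A B. A \<in> selfadjoint_ops \<Longrightarrow> B \<in> selfadjoint_ops \<Longrightarrow>
      A o\<^sub>L B = B o\<^sub>L A \<longleftrightarrow> \<phi> A o\<^sub>L \<phi> B = \<phi> B o\<^sub>L \<phi> A"
  shows "\<exists>(U :: 'a \<Rightarrow>\<^sub>L 'a) (l::real) (m::real). l > 0 \<and>
    (unitary U \<and>
       (\<forall>A\<in>selfadjoint_ops. \<phi> A = l *\<^sub>R (U o\<^sub>L A o\<^sub>L cadjoint U) + m *\<^sub>R id_blinfun) \<or>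
     antiunitary U \<and>
       (\<forall>A\<in>selfadjoint_ops. \<phi> A = l *\<^sub>R (U o\<^sub>L A o\<^sub>L conj_adjoint U) + m *\<^sub>R id_blinfun))"
proof -
  interpret order_commutativity_automorphism \<phi>
    using bij order commutativity by unfold_locales
  obtain u :: 'a where u: "norm u = 1" using half_overlap_vectors[OF dim] by metis
  have l: "scalar_map 1 - scalar_map 0 > 0" by (simp add: scalar_map_less_iff[OF u])
  obtain U :: "'a \<Rightarrow>\<^sub>L 'a" where U: "unitary U \<or> antiunitary U"
    and ray: "\<And>u. norm u = 1 \<Longrightarrow> rank_one (U u) = rank_one (ray_map u)"
    using ray_map_wigner[OF dim] by blast
  have "\<phi> A = (scalar_map 1 - scalar_map 0) *\<^sub>R (U o\<^sub>L A o\<^sub>L V) + scalar_map 0 *\<^sub>R id_blinfun"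
    if "symmetry_adjoint U V" "A \<in> selfadjoint_ops" for V A
    using automorphism_form[OF dim that(1) ray that(2) l] .
  then show ?thesis using U l unfolding symmetry_adjoint_def by blast
qed

end
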